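(* Suppose that there exist $\mathfrak c$ pairwise Rudin–Keisler incomparable selective ultrafilters on $\omega$. Then there exists a Hausdorff topological group $G$ such that $G^n$ is countably pracompact for every positive integer $n$, but $G^{\omega}$ is not countably pracompact.
   Context: A space $X$ is countably pracompact if there is a dense set $D\subseteq X$ such that every infinite subset of $D$ has an accumulation point in $X$. Selective ultrafilter: a free ultrafilter $p$ on $\omega$ such that for every partition $\{A_n\}$ of $\omega$ either some $A_n\in p$ or some $B\in p$ meets each $A_n$ in exactly one point. Rudin–Keisler: $p\le_{RK}q$ iff $p=\{A:f^{-1}(A)\in q\}$ for some $f:\omega\to\omega$; incomparable means neither $p\le_{RK}q$ nor $q\le_{RK}p$. Powers carry the product topology. *)

theory Defs
  imports "HOL-Analysis.Analysis" "HOL-Algebra.Group" "HOL-Library.Equipollence"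
begin

definition topological_group :: "('a, 'b) monoid_scheme \<Rightarrow> 'a topology \<Rightarrow> bool" where
  "topological_group G T \<longleftrightarrow>
     group G \<and> carrier G = topspace T \<and>
     continuous_map (prod_topology T T) T (\<lambda>(x, y). x \<otimes>\<^bsub>G\<^esub> y) \<and>
     continuous_map T T (\<lambda>x. inv\<^bsub>G\<^esub> x)"

definition countably_pracompact :: "'a topology \<Rightarrow> bool" where
  "countably_pracompact X \<longleftrightarrow>
     (\<exists>D. D \<subseteq> topspace X \<and> X closure_of D = topspace X \<and>
          (\<forall>A. A \<subseteq> D \<and> infinite A \<longrightarrow> X derived_set_of A \<noteq> {}))"

definition free_ultrafilter_nat :: "nat set set \<Rightarrow> bool" where
  "free_ultrafilter_nat p \<longleftrightarrow>
     UNIV \<in> p \<and> {} \<notin> p \<and>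
     (\<forall>A B. A \<in> p \<and> B \<in> p \<longrightarrow> A \<inter> B \<in> p) \<and>
     (\<forall>A B. A \<in> p \<and> A \<subseteq> B \<longrightarrow> B \<in> p) \<and>
     (\<forall>A. A \<in> p \<or> - A \<in> p) \<and>
     (\<forall>A. finite A \<longrightarrow> A \<notin> p)"

definition selective_ultrafilter :: "nat set set \<Rightarrow> bool" where
  "selective_ultrafilter p \<longleftrightarrow>
     free_ultrafilter_nat p \<and>
     (\<forall>A :: nat \<Rightarrow> nat set.
        (\<forall>n. A n \<noteq> {}) \<and> (\<forall>m n. m \<noteq> n \<longrightarrow> A m \<inter> A n = {}) \<and> (\<Union>n. A n) = UNIV
        \<longrightarrow> (\<exists>n. A n \<in> p) \<or> (\<exists>B\<in>p. \<forall>n. \<exists>!k. k \<in> B \<inter> A n))"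

definition rk_le :: "nat set set \<Rightarrow> nat set set \<Rightarrow> bool" where
  "rk_le p q \<longleftrightarrow> (\<exists>f :: nat \<Rightarrow> nat. p = {A. f -` A \<in> q})"

end

(* Let H be the countable Boolean group of polynomials over the two-element field. Its Bohr
   compactification consists of the F_2-linear functionals on the group of all characters of H.
   The group G is generated, inside this compactification, by H and, for every finite array
   (g_0, ..., g_{m-1}) of sequences in H that is linearly independent in a strong sense, by the
   limits of g_0, ..., g_{m-1} along one selective ultrafilter p assigned to this array alone.

   Every infinite subset of the dense subgroup H^n of G^n contains a sequence whose coordinates are,
   up to constants, sums of rows of such an array, hence has an accumulation point in G^n.

   Let D be dense in G^omega. If the elements of D involve infinitely many of the new generators in
   some coordinate, choose a sequence in D in which a new generator appears at every step.
   Otherwise choose d_k in D whose first k + 1 coordinates have H-parts that are independent modulo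
   a finite subgroup V_k containing all earlier H-parts. In both cases the sequence has no
   accumulation point y. Selectivity and incomparability provide sets in the countably many
   ultrafilters involved whose union is so sparse that all array entries along it are independent,
   so a character with prescribed limits along these ultrafilters can be found by solving a linear
   system. In the second case, if y were an accumulation point, at stage k only one index l of only
   one array would matter modulo V_k; that array has m rows, while more than 2^m coordinates have
   to be accounted for. *)

theory Submission
  imports
    Defs
    "HOL-Library.Z2"
    "HOL-Library.Function_Algebras"
    "HOL-Computational_Algebra.Polynomial"
begin


section \<open>Selective ultrafilters: sparse members for countably many pairwise incomparable
  ones\<close>

section \<open>Selective ultrafilters\<close>

lemma free_ultrafilter_natD:
  assumes "free_ultrafilter_nat p"
  shows "UNIV \<in> p" "{} \<notin> p" "\<And>A B. A \<in> p \<Longrightarrow> B \<in> p \<Longrightarrow> A \<inter> B \<in> p"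
    "\<And>A B. A \<in> p \<Longrightarrow> A \<subseteq> B \<Longrightarrow> B \<in> p" "\<And>A. A \<notin> p \<Longrightarrow> - A \<in> p"
    "\<And>A. finite A \<Longrightarrow> A \<notin> p"
  using assms unfolding free_ultrafilter_nat_def by metis+

lemma free_ultrafilter_nat_INT:
  assumes "free_ultrafilter_nat p" "finite I" "\<And>i. i \<in> I \<Longrightarrow> A i \<in> p"
  shows "(\<Inter>i\<in>I. A i) \<in> p"
  using assms(2,3)
  by (induction I rule: finite_induct) (auto intro: free_ultrafilter_natD[OF assms(1)])

lemma free_ultrafilter_nat_UN:
  assumes "free_ultrafilter_nat p" "finite I" "(\<Union>i\<in>I. A i) \<in> p"
  obtains i where "i \<in> I" "A i \<in> p"
proof (rule ccontr)
  assume "\<not> thesis"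
  with that have "A i \<notin> p" if "i \<in> I" for i
    using that by blast
  then have "(\<Inter>i\<in>I. - A i) \<in> p"
    using free_ultrafilter_natD(5)[OF assms(1)] by (intro free_ultrafilter_nat_INT assms) auto
  then have "(\<Inter>i\<in>I. - A i) \<inter> (\<Union>i\<in>I. A i) \<in> p"
    using free_ultrafilter_natD(3) assms by blast
  moreover have "(\<Inter>i\<in>I. - A i) \<inter> (\<Union>i\<in>I. A i) = {}"
    by auto
  ultimately show False
    using free_ultrafilter_natD(2)[OF assms(1)] by simp
qed

lemma free_ultrafilter_nat_Diff_finite:
  assumes "free_ultrafilter_nat p" "A \<in> p" "finite B"
  shows "A - B \<in> p"
proof -
  have "- B \<in> p"
    using assms free_ultrafilter_natD(5,6) by blast
  then have "A \<inter> - B \<in> p"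
    using assms free_ultrafilter_natD(3) by blast
  then show ?thesis
    by (simp add: Diff_eq)
qed

text \<open>The range of \<open>f\<close> is infinite, since otherwise finitely many fibres cover
  \<omega> and one of them belongs to \<open>p\<close>. So the fibres over the range, listed by
  \<open>enumerate\<close>, form a partition without a member of \<open>p\<close>, and on a selector
  of this partition \<open>f\<close> is injective.\<close>

lemma selective_ultrafilter_inj_on:
  assumes "selective_ultrafilter p" and fibre: "\<And>n. f -` {n} \<notin> p"
  obtains B where "B \<in> p" "inj_on (f :: nat \<Rightarrow> nat) B"
proof -
  have p: "free_ultrafilter_nat p"
    using assms(1) by (simp add: selective_ultrafilter_def)
  have inf: "infinite (range f)"
  proof
    assume "finite (range f)"
    moreover have "(\<Union>n\<in>range f. f -` {n}) = UNIV"
      by auto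
    then have "(\<Union>n\<in>range f. f -` {n}) \<in> p"
      using free_ultrafilter_natD(1)[OF p] by simp
    ultimately show False
      using free_ultrafilter_nat_UN[OF p] fibre by metis
  qed
  define A where "A n = f -` {enumerate (range f) n}" for n
  have "(\<exists>n. A n \<in> p) \<or> (\<exists>B\<in>p. \<forall>n. \<exists>!k. k \<in> B \<inter> A n)"
  proof -
    have "A n \<noteq> {}" for n
      using enumerate_in_set[OF inf, of n] by (auto simp: A_def)
    moreover have "A m \<inter> A n = {}" if "m \<noteq> n" for m n
      using that enumerate_mono[OF _ inf] by (auto simp: A_def) (metis nat_neq_iff)
    moreover have "(\<Union>n. A n) = UNIV"
      using range_enumerate[OF inf] by (auto simp: A_def) (metis imageE rangeI)
    ultimately show ?thesis
      using assms(1) unfolding selective_ultrafilter_def by blast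
  qed
  then obtain B where B: "B \<in> p" "\<And>n. \<exists>!k. k \<in> B \<inter> A n"
    using fibre by (auto simp: A_def)
  have "inj_on f B"
  proof
    fix x y assume xy: "x \<in> B" "y \<in> B" "f x = f y"
    obtain n where "f x = enumerate (range f) n"
      using range_enumerate[OF inf] by (metis imageE rangeI)
    with xy have "x \<in> B \<inter> A n" "y \<in> B \<inter> A n"
      by (auto simp: A_def)
    with B(2) show "x = y"
      by blast
  qed
  with B(1) that show ?thesis
    by blast
qed

text \<open>A selective ultrafilter is a P-point: let \<open>f l\<close> be the first stage at which
  \<open>l\<close> leaves the decreasing sequence \<open>U\<close>. The fibre of \<open>n\<close>
  misses \<open>U n\<close>, so \<open>f\<close> is injective on some member of \<open>p\<close>,
  and only finitely many of its points have left by stage \<open>n\<close>.\<close>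

lemma selective_ultrafilter_pseudo_intersection:
  assumes "selective_ultrafilter p" and W: "\<And>n. W n \<in> p"
  obtains A where "A \<in> p" "\<And>n::nat. finite (A - W n)"
proof -
  have p: "free_ultrafilter_nat p"
    using assms(1) by (simp add: selective_ultrafilter_def)
  \<comment> \<open>Removing \<open>{..n}\<close> makes every \<open>l\<close> leave at stage
    \<open>l\<close> at the latest, so that the minimum in \<open>f\<close> exists.\<close>
  define U where "U n = (\<Inter>i\<in>{..n}. W i) - {..n}" for n
  have U: "U n \<in> p" for n
    unfolding U_def by (intro free_ultrafilter_nat_Diff_finite free_ultrafilter_nat_INT p W) auto
  define f where "f l = (LEAST n. l \<notin> U n)" for l
  have f: "l \<notin> U (f l)" for l
    unfolding f_def by (rule LeastI[of _ l]) (simp add: U_def)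
  have f_less: "l \<in> U n" if "n < f l" for l n
    using not_less_Least that unfolding f_def by blast
  have "f -` {n} \<notin> p" for n
  proof
    assume "f -` {n} \<in> p"
    then have "f -` {n} \<inter> U n \<in> p"
      using U p free_ultrafilter_natD(3) by blast
    moreover have "f -` {n} \<inter> U n = {}"
      using f by auto
    ultimately show False
      using free_ultrafilter_natD(2)[OF p] by simp
  qed
  then obtain B where B: "B \<in> p" "inj_on f B"
    using selective_ultrafilter_inj_on[OF assms(1)] by blast
  have "finite (B - W n)" for n
  proof (rule inj_on_finite)
    show "inj_on f (B - W n)"
      using B(2) by (rule inj_on_subset) auto
    show "f ` (B - W n) \<subseteq> {..n}"
      using f_less by (force simp: U_def not_less[symmetric])
  qed auto
  with B(1) that show ?thesis
    by blast
qed

text \<open>The hypothesis \<open>eq\<close> says that \<open>r\<close> maps \<open>q\<close> and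
  \<open>f\<close> maps \<open>p\<close> to the same ultrafilter. An inverse of \<open>r\<close> on
  \<open>B\<close> carries this image back to \<open>q\<close>, so its composition with
  \<open>f\<close> carries \<open>p\<close> to \<open>q\<close>.\<close>

lemma rk_le_image_inj_on:
  assumes p: "free_ultrafilter_nat p" and q: "free_ultrafilter_nat q"
    and B: "B \<in> q" "inj_on r B" and eq: "\<And>C. r -` C \<in> q \<longleftrightarrow> f -` C \<in> p"
  shows "rk_le q p"
proof -
  define b where "b = inv_into B r"
  have "(A \<in> q) = ((b \<circ> f) -` A \<in> p)" for A
  proof -
    have "A \<in> q \<longleftrightarrow> A \<inter> B \<in> q"
      using B(1) free_ultrafilter_natD[OF q] by (meson inf_le1)
    also have "A \<inter> B = (r -` (b -` A)) \<inter> B"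
      using B(2) by (auto simp: b_def)
    also have "\<dots> \<in> q \<longleftrightarrow> r -` (b -` A) \<in> q"
      using B(1) free_ultrafilter_natD[OF q] by (meson inf_le1)
    also have "\<dots> \<longleftrightarrow> (b \<circ> f) -` A \<in> p"
      using eq[of "b -` A"] by (simp add: vimage_comp)
    finally show ?thesis .
  qed
  then have "q = {A. (b \<circ> f) -` A \<in> p}"
    by blast
  then show ?thesis
    unfolding rk_le_def by blast
qed

text \<open>Otherwise the images of \<open>q\<close> under \<open>r\<close> and of \<open>p\<close>
  under \<open>f\<close> would coincide, which \<open>rk_le_image_inj_on\<close> rules out.\<close>

lemma rk_incomparable_separate:
  assumes p: "free_ultrafilter_nat p" and q: "free_ultrafilter_nat q"
    and "B \<in> q" "inj_on r B" "\<not> rk_le q p"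
  obtains C where "r -` C \<in> q" "- (f -` C) \<in> p"
proof -
  obtain C where C: "(r -` C \<in> q) \<noteq> (f -` C \<in> p)"
    using rk_le_image_inj_on[OF p q assms(3,4)] assms(5) by blast
  show ?thesis
  proof (cases "r -` C \<in> q")
    case True
    with C that[of C] show ?thesis
      using free_ultrafilter_natD(5)[OF p] by blast
  next
    case False
    then have "- (r -` C) \<in> q"
      using free_ultrafilter_natD(5)[OF q] by blast
    moreover have "- (r -` C) = r -` (- C)" "- (f -` (- C)) = f -` C"
      by auto
    ultimately show ?thesis
      using that[of "- C"] C False by metis
  qed
qed

text \<open>\<open>r l\<close> is the number of the interval \<open>[E n, E (n + 1))\<close> that
  contains \<open>l\<close>. The endpoints grow so fast that \<open>F\<close> stays below
  \<open>E (n + 2)\<close> on the \<open>n\<close>-th interval; hence one full interval between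
  \<open>l\<close> and \<open>l'\<close> suffices.\<close>

lemma growing_intervals:
  fixes F :: "nat \<Rightarrow> nat"
  obtains r :: "nat \<Rightarrow> nat" where "\<And>n. finite (r -` {n})" "mono r"
    "\<And>l l'. r l + 2 \<le> r l' \<Longrightarrow> F l < l'"
proof -
  \<comment> \<open>The sum bounds all values of \<open>F\<close> up to \<open>e\<close>; adding
    \<open>e\<close> and one makes \<open>E\<close> strictly increasing.\<close>
  define E where "E = rec_nat 0 (\<lambda>_ e. Suc (e + (\<Sum>l\<le>e. F l)))"
  have E0: "E 0 = 0" and ES: "E (Suc n) = Suc (E n + (\<Sum>l\<le>E n. F l))" for n
    by (simp_all add: E_def)
  have "strict_mono E"
    by (simp add: strict_mono_Suc_iff ES)
  have EF: "F l < E (Suc n)" if "l \<le> E n" for l n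
  proof -
    have "F l \<le> (\<Sum>l\<le>E n. F l)"
      using that by (intro member_le_sum) auto
    then show ?thesis
      by (simp add: ES)
  qed
  define r where "r l = (LEAST n. l < E (Suc n))" for l
  have upper: "l < E (Suc (r l))" for l
    unfolding r_def
    by (rule LeastI[of _ l]) (use \<open>strict_mono E\<close> in \<open>meson Suc_le_lessD strict_mono_imp_increasing\<close>)
  have r_le: "r l \<le> n" if "l < E (Suc n)" for l n
    unfolding r_def by (rule Least_le) (rule that)
  have lower: "E (r l) \<le> l" for l
  proof (cases "r l")
    case (Suc n)
    then show ?thesis
      using r_le[of l n] by (metis not_less_eq_eq order_refl not_le)
  qed (simp add: E0)
  have fin: "finite (r -` {n})" for n
    by (rule finite_subset[of _ "{..<E (Suc n)}"]) (use upper in auto)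
  have mono: "mono r"
  proof
    fix l l' :: nat assume "l \<le> l'"
    then show "r l \<le> r l'"
      using upper[of l'] by (intro r_le) simp
  qed
  have far: "F l < l'" if "r l + 2 \<le> r l'" for l l'
  proof -
    have "F l < E (Suc (Suc (r l)))"
      using upper[of l] by (intro EF) simp
    also have "\<dots> \<le> E (r l')"
      using that strict_mono_mono[OF \<open>strict_mono E\<close>] by (intro monoD[where f=E]) auto
    also have "\<dots> \<le> l'"
      by (rule lower)
    finally show ?thesis .
  qed
  show ?thesis
    using that[OF fin mono far] by blast
qed

text \<open>Three separations of images keep the interval numbers apart: \<open>C0\<close> excludes
  that they are equal, \<open>C1\<close> and \<open>C2\<close> that one is the successor of the
  other.\<close>

lemma rk_incomparable_far:
  fixes r :: "nat \<Rightarrow> nat"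
  assumes p: "free_ultrafilter_nat p" and q: "free_ultrafilter_nat q"
    and B: "B \<in> p" "inj_on r B" and C: "C \<in> q" "inj_on r C"
    and "\<not> rk_le p q" "\<not> rk_le q p"
  obtains U V where "U \<in> p" "V \<in> q"
    "\<And>l l'. l \<in> U \<Longrightarrow> l' \<in> V \<Longrightarrow> r l + 2 \<le> r l' \<or> r l' + 2 \<le> r l"
proof -
  obtain C0 where C0: "r -` C0 \<in> q" "- (r -` C0) \<in> p"
    using rk_incomparable_separate[OF p q C assms(8)] by blast
  obtain C1 where C1: "r -` C1 \<in> q" "- ((\<lambda>l. Suc (r l)) -` C1) \<in> p"
    using rk_incomparable_separate[OF p q C assms(8)] by blast
  obtain C2 where C2: "r -` C2 \<in> p" "- ((\<lambda>l. Suc (r l)) -` C2) \<in> q"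
    using rk_incomparable_separate[OF q p B assms(7)] by blast
  show ?thesis
  proof (rule that)
    show "- (r -` C0) \<inter> (- ((\<lambda>l. Suc (r l)) -` C1) \<inter> r -` C2) \<in> p"
      using C0 C1 C2 free_ultrafilter_natD(3)[OF p] by blast
    show "r -` C0 \<inter> (r -` C1 \<inter> - ((\<lambda>l. Suc (r l)) -` C2)) \<in> q"
      using C0 C1 C2 free_ultrafilter_natD(3)[OF q] by blast
  next
    fix l l'
    assume "l \<in> - (r -` C0) \<inter> (- ((\<lambda>l. Suc (r l)) -` C1) \<inter> r -` C2)"
      and "l' \<in> r -` C0 \<inter> (r -` C1 \<inter> - ((\<lambda>l. Suc (r l)) -` C2))"
    then have "r l \<noteq> r l'" "Suc (r l) \<noteq> r l'" "Suc (r l') \<noteq> r l"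
      by auto
    then show "r l + 2 \<le> r l' \<or> r l' + 2 \<le> r l"
      by linarith
  qed
qed

text \<open>The aim is to keep any two points of the union at least two intervals of
  \<open>growing_intervals\<close> apart. For a single pair this is achieved by \<open>W s t\<close>
  and \<open>W t s\<close>. A pseudo-intersection \<open>A s\<close> is almost contained in every
  \<open>W s t\<close>, and the finite errors are removed afterwards.\<close>

lemma selective_ultrafilters_sparse:
  fixes p :: "'s \<Rightarrow> nat set set" and K :: "'s \<Rightarrow> nat \<Rightarrow> nat"
  assumes sel: "\<And>s. s \<in> S \<Longrightarrow> selective_ultrafilter (p s)"
    and incomparable: "\<And>s t. s \<in> S \<Longrightarrow> t \<in> S \<Longrightarrow> s \<noteq> t \<Longrightarrow> \<not> rk_le (p s) (p t)"
    and S: "countable S"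
  obtains A where "\<And>s. s \<in> S \<Longrightarrow> A s \<in> p s"
    and "\<And>s t l l'. s \<in> S \<Longrightarrow> t \<in> S \<Longrightarrow> l \<in> A s \<Longrightarrow> l' \<in> A t \<Longrightarrow> l < l' \<Longrightarrow> K s l < l'"
    and "\<And>s t. s \<in> S \<Longrightarrow> t \<in> S \<Longrightarrow> s \<noteq> t \<Longrightarrow> A s \<inter> A t = {}"
proof -
  have free: "free_ultrafilter_nat (p s)" if "s \<in> S" for s
    using sel[OF that] by (simp add: selective_ultrafilter_def)
  define idx where "idx = to_nat_on S"
  have idx: "inj_on idx S"
    using S unfolding idx_def by (rule inj_on_to_nat_on)
  \<comment> \<open>Only finitely many \<open>s\<close> are summed at each \<open>l\<close>, so one
    function \<open>F\<close> bounds every \<open>K s\<close> from \<open>idx s\<close> on. Smaller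
    arguments are removed in \<open>A'\<close>.\<close>
  define F where "F l = (\<Sum>s\<in>{s\<in>S. idx s \<le> l}. K s l)" for l
  have F: "K s l \<le> F l" if "s \<in> S" "idx s \<le> l" for s l
  proof -
    have "finite {s\<in>S. idx s \<le> l}"
      by (rule inj_on_finite[of idx _ "{..l}"]) (use idx in \<open>auto intro: inj_on_subset\<close>)
    then show ?thesis
      unfolding F_def using that by (intro member_le_sum) auto
  qed
  obtain r :: "nat \<Rightarrow> nat" where r: "\<And>n. finite (r -` {n})" "mono r" "\<And>l l'. r l + 2 \<le> r l' \<Longrightarrow> F l < l'"
    using growing_intervals by blast
  have "\<exists>B. B \<in> p s \<and> inj_on r B" if "s \<in> S" for s
    using selective_ultrafilter_inj_on[OF sel[OF that], of r] r(1) free_ultrafilter_natD(6)[OF free[OF that]]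
    by metis
  then obtain B where B: "\<And>s. s \<in> S \<Longrightarrow> B s \<in> p s" "\<And>s. s \<in> S \<Longrightarrow> inj_on r (B s)"
    by metis
  define far where "far l l' \<longleftrightarrow> r l + 2 \<le> r l' \<or> r l' + 2 \<le> r l" for l l'
  define sep where "sep s t U V \<longleftrightarrow> U \<in> p s \<and> V \<in> p t \<and> (\<forall>l\<in>U. \<forall>l'\<in>V. far l l')" for s t U V
  have "\<exists>U V. sep s t U V" if st: "s \<in> S" "t \<in> S" "s \<noteq> t" for s t
  proof -
    obtain U V where "U \<in> p s" "V \<in> p t" "\<And>l l'. l \<in> U \<Longrightarrow> l' \<in> V \<Longrightarrow> far l l'"
      unfolding far_def
      by (rule rk_incomparable_far[OF free[OF st(1)] free[OF st(2)] B(1)[OF st(1)] B(2)[OF st(1)]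
            B(1)[OF st(2)] B(2)[OF st(2)]]) (use st incomparable in auto)
    then show ?thesis
      unfolding sep_def by blast
  qed
  then obtain U V where "\<And>s t. s \<in> S \<Longrightarrow> t \<in> S \<Longrightarrow> s \<noteq> t \<Longrightarrow> sep s t (U s t) (V s t)"
    by metis
  then have UV: "U s t \<in> p s" "V s t \<in> p t" "\<And>l l'. l \<in> U s t \<Longrightarrow> l' \<in> V s t \<Longrightarrow> far l l'"
    if "s \<in> S" "t \<in> S" "s \<noteq> t" for s t
    using that by (auto simp: sep_def)
  \<comment> \<open>Injectivity of \<open>r\<close> on \<open>B s\<close> still allows adjacent
    interval numbers; fixing the parity that prevails in \<open>p s\<close> rules them out.\<close>
  define e where "e s \<longleftrightarrow> {l. even (r l)} \<in> p s" for s
  have e: "{l. even (r l) = e s} \<in> p s" if "s \<in> S" for s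
  proof (cases "e s")
    case False
    then have "- {l. even (r l)} \<in> p s"
      unfolding e_def by (rule free_ultrafilter_natD(5)[OF free[OF that]])
    moreover have "- {l. even (r l)} = {l. even (r l) = e s}"
      using False by auto
    ultimately show ?thesis
      by simp
  qed (simp add: e_def)
  define W where "W s t = (if s = t then B s \<inter> {l. even (r l) = e s} else U s t \<inter> V t s)" for s t
  have W: "W s t \<in> p s" if "s \<in> S" "t \<in> S" for s t
    using that UV(1)[of s t] UV(2)[of t s] B(1) e free_ultrafilter_natD(3)[OF free[OF that(1)]]
    by (auto simp: W_def)
  have W_far: "far l l'" if "s \<in> S" "t \<in> S" "l \<in> W s t" "l' \<in> W t s" "s \<noteq> t \<or> l \<noteq> l'" for s t l l'
  proof (cases "s = t")
    case True
    then have *: "l \<in> B s" "l' \<in> B s" "even (r l) = e s" "even (r l') = e s" "l \<noteq> l'"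
      using that by (simp_all add: W_def)
    then have "r l \<noteq> r l'"
      using inj_onD[OF B(2)[OF that(1)]] by blast
    moreover have "even (r l) \<longleftrightarrow> even (r l')"
      using * by simp
    ultimately show ?thesis
      unfolding far_def by presburger
  next
    case False
    then have "l \<in> U s t" "l' \<in> V s t"
      using that by (simp_all add: W_def)
    then show ?thesis
      by (rule UV(3)[OF that(1,2) False])
  qed
  have "\<exists>A. A \<in> p s \<and> (\<forall>t\<in>S. finite (A - W s t))" if s: "s \<in> S" for s
  proof -
    have W': "W s (from_nat_into S n) \<in> p s" for n
      by (rule W[OF s from_nat_into]) (use s in auto)
    obtain A where A: "A \<in> p s" "\<And>n. finite (A - W s (from_nat_into S n))"
      using selective_ultrafilter_pseudo_intersection[OF sel[OF s], of "\<lambda>n. W s (from_nat_into S n)"] W'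
      by metis
    have "finite (A - W s t)" if "t \<in> S" for t
      using from_nat_into_surj[OF S that] A(2) by metis
    with A(1) show ?thesis
      by blast
  qed
  then have "\<forall>s\<in>S. \<exists>A. A \<in> p s \<and> (\<forall>t\<in>S. finite (A - W s t))"
    by blast
  from bchoice[OF this] obtain A where A: "\<And>s. s \<in> S \<Longrightarrow> A s \<in> p s" "\<And>s t. s \<in> S \<Longrightarrow> t \<in> S \<Longrightarrow> finite (A s - W s t)"
    by blast
  define bad where "bad s t = {l. \<exists>l'. \<not> far l l' \<and> (l \<in> A s - W s t \<or> l' \<in> A t - W t s)}" for s t
  have bad: "finite (bad s t)" if "s \<in> S" "t \<in> S" for s t
  proof -
    have near: "finite {l. \<not> far l l'}" for l'
    proof (rule finite_subset)
      show "{l. \<not> far l l'} \<subseteq> (\<Union>n\<le>r l' + 2. r -` {n})"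
        by (auto simp: far_def)
    qed (use r(1) in auto)
    have "bad s t \<subseteq> (A s - W s t) \<union> (\<Union>l'\<in>A t - W t s. {l. \<not> far l l'})"
      by (auto simp: bad_def)
    then show ?thesis
      by (rule finite_subset) (use A(2) that near in auto)
  qed
  \<comment> \<open>A pair \<open>s\<close>, \<open>t\<close> is repaired only on the side with the
    larger \<open>idx\<close>, so that each \<open>A s\<close> loses only finitely many
    points.\<close>
  define A' where "A' s = A s - ((\<Union>t\<in>{t\<in>S. idx t \<le> idx s}. bad s t) \<union> {..<idx s})" for s
  have fin: "finite {t\<in>S. idx t \<le> n}" for n
    by (rule inj_on_finite[of idx _ "{..n}"]) (use idx in \<open>auto intro: inj_on_subset\<close>)
  have A': "A' s \<in> p s" if "s \<in> S" for s
    unfolding A'_def using that bad fin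
    by (intro free_ultrafilter_nat_Diff_finite free A) auto
  have far_sym: "far l l' = far l' l" for l l'
    by (auto simp: far_def)
  have A'_far: "far l l'" if "s \<in> S" "t \<in> S" "l \<in> A' s" "l' \<in> A' t" "s \<noteq> t \<or> l \<noteq> l'" for s t l l'
    using that
  proof (induction "idx s" "idx t" arbitrary: s t l l' rule: linorder_wlog)
    case le
    then have "l' \<notin> bad t s" "l \<in> A s" "l' \<in> A t"
      by (auto simp: A'_def)
    then show ?case
      using W_far[of s t l l'] le far_sym by (auto simp: bad_def)
  next
    case (sym s t)
    then show ?case
      using far_sym by metis
  qed
  show ?thesis
  proof (rule that)
    show "A' s \<in> p s" if "s \<in> S" for s
      using that by (rule A')
  next
    fix s t l l' assume *: "s \<in> S" "t \<in> S" "l \<in> A' s" "l' \<in> A' t" "l < l'"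
    then have "far l l'"
      using A'_far by blast
    moreover have "r l \<le> r l'"
      using r(2) *(5) by (simp add: monoD)
    ultimately have "F l < l'"
      by (intro r(3)) (auto simp: far_def)
    moreover have "K s l \<le> F l"
      using * by (intro F) (auto simp: A'_def)
    ultimately show "K s l < l'"
      by linarith
  next
    fix s t assume "s \<in> S" "t \<in> S" "s \<noteq> t"
    then have "far l l" if "l \<in> A' s" "l \<in> A' t" for l
      using that A'_far by blast
    moreover have "\<not> far l l" for l
      by (simp add: far_def)
    ultimately show "A' s \<inter> A' t = {}"
      by blast
  qed
qed


section \<open>Vector spaces over the two-element field: characters and linear systems\<close>

section \<open>Boolean groups\<close>

declare add_bit_eq_xor [simp del] mult_bit_eq_and [simp del]

class boolean_group = ab_group_add +
  assumes add_self [simp]: "x + x = 0"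
begin

lemma minus_eq_self: "- x = x"
  using add_self[of x] by (simp add: minus_unique)

lemma diff_eq_add: "x - y = x + y"
  using diff_conv_add_uminus[of x y] by (simp add: minus_eq_self)

lemma add_self_left [simp]: "x + (x + y) = y"
  by (simp flip: add.assoc)

lemma add_eq_zero_iff: "x + y = 0 \<longleftrightarrow> x = y"
  using eq_iff_diff_eq_0[of x y] by (simp add: diff_eq_add)

text \<open>Common terms occur twice and cancel. Consequently the finite subset sums of a family
  form a subgroup.\<close>

lemma sum_sym_diff:
  assumes "finite X" "finite Y"
  shows "sum f (sym_diff X Y) = sum f X + sum f Y"
proof -
  have "sum f X = sum f (X \<inter> Y) + sum f (X - Y)"
    using assms(1) by (rule sum.Int_Diff)
  moreover have "sum f Y = sum f (X \<inter> Y) + sum f (Y - X)"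
    using assms(2) sum.Int_Diff[of Y f X] by (simp add: Int_commute)
  moreover have "sum f (sym_diff X Y) = sum f (X - Y) + sum f (Y - X)"
    using assms by (intro sum.union_disjoint) auto
  ultimately show ?thesis
    by (simp add: ac_simps)
qed

end

instance bit :: boolean_group
  by standard (metis bit_2_eq_0 mult_2 mult_zero_left)

instance "fun" :: (type, boolean_group) boolean_group
  by standard (simp add: fun_eq_iff)

instance prod :: (boolean_group, boolean_group) boolean_group
  by standard (simp add: prod_eq_iff)

instance poly :: ("{boolean_group,comm_ring_1}") boolean_group
  by standard (rule poly_eqI, simp only: coeff_add add_self coeff_0)

text \<open>A maximal subgroup among those containing \<open>R\<close> but not \<open>u\<close> has index two.\<close>

lemma boolean_group_character:
  fixes u :: "'a :: boolean_group"
  assumes "0 \<in> R" "\<And>x y. x \<in> R \<Longrightarrow> y \<in> R \<Longrightarrow> x + y \<in> R" "u \<notin> R"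
  obtains \<psi> :: "'a \<Rightarrow> bit" where "Modules.additive \<psi>" "\<And>x. x \<in> R \<Longrightarrow> \<psi> x = 0" "\<psi> u = 1"
proof -
  define \<M> where "\<M> = {M. R \<subseteq> M \<and> u \<notin> M \<and> (\<forall>x\<in>M. \<forall>y\<in>M. x + y \<in> M)}"
  have "\<exists>U\<in>\<M>. \<forall>X\<in>\<C>. X \<subseteq> U" if "subset.chain \<M> \<C>" for \<C>
  proof (cases "\<C> = {}")
    case True
    then show ?thesis
      using assms by (auto simp: \<M>_def)
  next
    case False
    have sub: "\<C> \<subseteq> \<M>" and lin: "\<And>X Y. X \<in> \<C> \<Longrightarrow> Y \<in> \<C> \<Longrightarrow> X \<subseteq> Y \<or> Y \<subseteq> X"
      using that by (auto simp: subset_chain_def)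
    have mem: "R \<subseteq> X" "u \<notin> X" "x \<in> X \<Longrightarrow> y \<in> X \<Longrightarrow> x + y \<in> X" if "X \<in> \<C>" for X x y
      using that sub by (auto simp: \<M>_def)
    have "x + y \<in> \<Union>\<C>" if "x \<in> \<Union>\<C>" "y \<in> \<Union>\<C>" for x y
    proof -
      obtain X Y where XY: "X \<in> \<C>" "Y \<in> \<C>" "x \<in> X" "y \<in> Y"
        using \<open>x \<in> \<Union>\<C>\<close> \<open>y \<in> \<Union>\<C>\<close> by blast
      then obtain Z where "Z \<in> \<C>" "x \<in> Z" "y \<in> Z"
        using lin[of X Y] by blast
      then show ?thesis
        using mem(3) by blast
    qed
    moreover have "R \<subseteq> \<Union>\<C>" "u \<notin> \<Union>\<C>"
      using mem(1,2) False by blast+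
    ultimately have "\<Union>\<C> \<in> \<M>"
      by (simp add: \<M>_def)
    then show ?thesis
      by blast
  qed
  from subset_Zorn[OF this] obtain M where M: "M \<in> \<M>" "\<And>X. X \<in> \<M> \<Longrightarrow> M \<subseteq> X \<Longrightarrow> X = M"
    by blast
  have add: "x + y \<in> M" if "x \<in> M" "y \<in> M" for x y
    using that M(1) by (auto simp: \<M>_def)
  have R: "R \<subseteq> M" "0 \<in> M" and u: "u \<notin> M"
    using M(1) assms(1) by (auto simp: \<M>_def)
  have compl: "x + u \<in> M" if "x \<notin> M" for x
  proof (rule ccontr)
    assume *: "x + u \<notin> M"
    \<comment> \<open>\<open>M'\<close> is the subgroup generated by \<open>M\<close> and
      \<open>x\<close>. It avoids \<open>u\<close> because neither \<open>u\<close> nor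
      \<open>x + u\<close> is in \<open>M\<close>.\<close>
    define M' where "M' = M \<union> {y. x + y \<in> M}"
    have "y + z \<in> M'" if yz: "y \<in> M'" "z \<in> M'" for y z
    proof -
      have eqs: "(x + y) + z = x + (y + z)" "y + (x + z) = x + (y + z)" "(x + y) + (x + z) = y + z"
        by (simp_all add: ac_simps)
      show ?thesis
        using yz add[of y z] add[of "x + y" z] add[of y "x + z"] add[of "x + y" "x + z"]
        unfolding M'_def eqs by blast
    qed
    then have "M' \<in> \<M>"
      using R u * by (auto simp: \<M>_def M'_def)
    then have "M' = M"
      using M(2) by (auto simp: M'_def)
    moreover have "x \<in> M'"
      using R by (simp add: M'_def)
    ultimately show False
      using that by simp
  qed
  define \<psi> :: "'a \<Rightarrow> bit" where "\<psi> x = (if x \<in> M then 0 else 1)" for x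
  have "\<psi> (x + y) = \<psi> x + \<psi> y" for x y
  proof -
    have "y \<in> M" if "x + y \<in> M" "x \<in> M"
      using add[OF that(2,1)] by simp
    moreover have "x \<in> M" if "x + y \<in> M" "y \<in> M"
      using add[OF that] by (simp add: add.assoc)
    moreover have "x + y \<in> M" if "x \<notin> M" "y \<notin> M"
      using add[OF compl[OF that(1)] compl[OF that(2)]] by (simp add: ac_simps)
    ultimately have "x + y \<in> M \<longleftrightarrow> (x \<in> M \<longleftrightarrow> y \<in> M)"
      using add[of x y] by blast
    then show ?thesis
      by (simp add: \<psi>_def)
  qed
  then have "Modules.additive \<psi>"
    by (simp add: Modules.additive_def)
  moreover have "\<psi> x = 0" if "x \<in> R" for x
    using that R(1) by (auto simp: \<psi>_def)
  moreover have "\<psi> u = 1"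
    using u by (simp add: \<psi>_def)
  ultimately show ?thesis
    by (rule that)
qed

text \<open>Equation \<open>i\<close> becomes the pair \<open>(f i, c i)\<close>, and
  \<open>R\<close> is the span of these pairs. By consistency \<open>(0, 1)\<close> is outside
  \<open>R\<close>; a character that kills \<open>R\<close> and takes the value one at
  \<open>(0, 1)\<close> solves the system when restricted to the first factor.\<close>

lemma additive_system_solvable:
  fixes f :: "'i \<Rightarrow> 'a :: boolean_group" and c :: "'i \<Rightarrow> bit"
  assumes "\<And>Y. finite Y \<Longrightarrow> Y \<subseteq> I \<Longrightarrow> (\<Sum>i\<in>Y. f i) = 0 \<Longrightarrow> (\<Sum>i\<in>Y. c i) = 0"
  obtains \<psi> :: "'a \<Rightarrow> bit" where "Modules.additive \<psi>" "\<And>i. i \<in> I \<Longrightarrow> \<psi> (f i) = c i"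
proof -
  define R where "R = {\<Sum>i\<in>Y. (f i, c i) | Y. finite Y \<and> Y \<subseteq> I}"
  have sum_Pair: "(\<Sum>i\<in>Y. (f i, c i)) = (\<Sum>i\<in>Y. f i, \<Sum>i\<in>Y. c i)" for Y
    by (induction Y rule: infinite_finite_induct) (auto simp: zero_prod_def)
  have R_I: "(\<Sum>i\<in>Y. (f i, c i)) \<in> R" if "finite Y" "Y \<subseteq> I" for Y
    using that unfolding R_def by blast
  have "0 \<in> R"
    using R_I[of "{}"] by simp
  moreover have "x + y \<in> R" if xy: "x \<in> R" "y \<in> R" for x y
  proof -
    from xy(1) obtain X where X: "finite X" "X \<subseteq> I" "x = (\<Sum>i\<in>X. (f i, c i))"
      unfolding R_def by blast
    from xy(2) obtain Y where Y: "finite Y" "Y \<subseteq> I" "y = (\<Sum>i\<in>Y. (f i, c i))"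
      unfolding R_def by blast
    have "x + y = (\<Sum>i\<in>sym_diff X Y. (f i, c i))"
      unfolding X(3) Y(3) by (rule sum_sym_diff[OF X(1) Y(1), symmetric])
    also have "\<dots> \<in> R"
      using X(1,2) Y(1,2) by (intro R_I) auto
    finally show ?thesis .
  qed
  moreover have "(0, 1) \<notin> R"
    using assms by (auto simp: R_def sum_Pair)
  ultimately obtain \<psi> :: "'a \<times> bit \<Rightarrow> bit" where \<psi>: "Modules.additive \<psi>" "\<And>x. x \<in> R \<Longrightarrow> \<psi> x = 0" "\<psi> (0, 1) = 1"
    by (rule boolean_group_character) auto
  note add = Modules.additive.add[OF \<psi>(1)]
  have "\<psi> (f i, 0) = c i" if "i \<in> I" for i
  proof -
    have "(f i, c i) \<in> R"
      using R_I[of "{i}"] that by simp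
    moreover have "\<psi> (0, c i) = c i"
      using \<psi>(3) Modules.additive.zero[OF \<psi>(1)] by (cases "c i") (simp_all add: zero_prod_def)
    ultimately show ?thesis
      using \<psi>(2) add[of "(f i, 0)" "(0, c i)"] by (simp add: add_eq_zero_iff)
  qed
  moreover have "Modules.additive (\<lambda>x. \<psi> (x, 0))"
    by standard (simp flip: add)
  ultimately show ?thesis
    using that by blast
qed

section \<open>The countable group of polynomials, its characters and its escaping arrays\<close>

section \<open>Polynomials over the two-element field\<close>

text \<open>The sequence \<open>A\<close> encodes an arbitrary character of the polynomial group by
  its values on the monomials.\<close>

definition pairing :: "(nat \<Rightarrow> bit) \<Rightarrow> bit poly \<Rightarrow> bit" where
  "pairing A h = (\<Sum>i\<le>degree h. coeff h i * A i)"

lemma pairing_eq: "degree h \<le> N \<Longrightarrow> pairing A h = (\<Sum>i\<le>N. coeff h i * A i)"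
  unfolding pairing_def by (rule sum.mono_neutral_left) (auto simp: coeff_eq_0)

lemma pairing_add: "pairing A (g + h) = pairing A g + pairing A h"
proof -
  define N where "N = max (degree g) (degree h)"
  have "degree (g + h) \<le> N" "degree g \<le> N" "degree h \<le> N"
    by (auto simp: N_def degree_add_le_max)
  then show ?thesis
    by (simp add: pairing_eq[of _ N] distrib_right sum.distrib del: sum.atMost_Suc)
qed

lemma pairing_0 [simp]: "pairing A 0 = 0"
  by (simp add: pairing_def)

lemma pairing_sum: "pairing A (sum f I) = (\<Sum>i\<in>I. pairing A (f i))"
  by (induction I rule: infinite_finite_induct) (simp_all add: pairing_add)

lemma pairing_additive:
  assumes "Modules.additive \<phi>"
  shows "pairing (\<lambda>i. \<phi> (monom 1 i)) h = \<phi> h"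
proof -
  have "\<phi> h = \<phi> (\<Sum>i\<le>degree h. monom (coeff h i) i)"
    by (simp add: poly_as_sum_of_monoms)
  also have "\<dots> = (\<Sum>i\<le>degree h. \<phi> (monom (coeff h i) i))"
    by (rule Modules.additive.sum[OF assms])
  also have "\<dots> = (\<Sum>i\<le>degree h. coeff h i * \<phi> (monom 1 i))"
  proof (rule sum.cong)
    show "\<phi> (monom (coeff h i) i) = coeff h i * \<phi> (monom 1 i)" for i
      using Modules.additive.zero[OF assms] by (cases "coeff h i") auto
  qed simp
  finally show ?thesis
    by (simp add: pairing_def)
qed

text \<open>These finite subgroups increase to the whole group; they are the finite subgroups modulo
  which independence is measured.\<close>

definition low :: "nat \<Rightarrow> bit poly set" where
  "low N = {h. \<forall>i\<ge>N. coeff h i = 0}"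

lemma low_add: "g \<in> low N \<Longrightarrow> h \<in> low N \<Longrightarrow> g + h \<in> low N"
  by (simp add: low_def)

lemma low_0 [simp]: "0 \<in> low N"
  by (simp add: low_def)

lemma low_sum: "(\<And>i. i \<in> I \<Longrightarrow> f i \<in> low N) \<Longrightarrow> sum f I \<in> low N"
  by (simp add: low_def coeff_sum)

lemma low_add_iff: "h \<in> low N \<Longrightarrow> g + h \<in> low N \<longleftrightarrow> g \<in> low N"
  by (auto simp: low_def)

lemma low_mono: "h \<in> low M \<Longrightarrow> M \<le> N \<Longrightarrow> h \<in> low N"
  by (simp add: low_def)

lemma monom_in_low_iff: "monom 1 i \<in> low N \<longleftrightarrow> i < N"
  by (auto simp: low_def not_le[symmetric])

lemma finite_low: "finite (low N)"
proof (rule inj_on_finite)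
  show "inj_on (\<lambda>h. {i. coeff h i = 1}) (low N)"
  proof
    fix g h :: "bit poly" assume "{i. coeff g i = 1} = {i. coeff h i = 1}"
    then have "coeff g i = 1 \<longleftrightarrow> coeff h i = 1" for i
      by blast
    then have "coeff g i = coeff h i" for i
      by (metis bit_not_one_iff)
    then show "g = h"
      by (simp add: poly_eq_iff)
  qed
  show "(\<lambda>h. {i. coeff h i = 1}) ` low N \<subseteq> Pow {..<N}"
    by (auto simp: low_def) (metis not_le zero_neq_one)
qed simp

lemma finite_imp_low:
  assumes "finite H"
  obtains N where "H \<subseteq> low N" "N \<ge> M"
proof
  show "H \<subseteq> low (M + (\<Sum>h\<in>H. Suc (degree h)))"
  proof
    fix h assume "h \<in> H"
    then have "Suc (degree h) \<le> (\<Sum>h\<in>H. Suc (degree h))"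
      using assms by (intro member_le_sum) auto
    then show "h \<in> low (M + (\<Sum>h\<in>H. Suc (degree h)))"
      by (auto simp: low_def coeff_eq_0)
  qed
qed simp

text \<open>This is the strong independence of an array with \<open>m\<close> rows: its column
  \<open>l\<close> is linearly independent modulo \<open>low l\<close>.\<close>

definition escaping :: "nat \<Rightarrow> (nat \<Rightarrow> nat \<Rightarrow> bit poly) \<Rightarrow> bool" where
  "escaping m g \<longleftrightarrow> (\<forall>l J. J \<subseteq> {..<m} \<and> J \<noteq> {} \<longrightarrow> (\<Sum>j\<in>J. g j l) \<notin> low l)"

lemma strict_mono_choice:
  fixes P :: "nat \<Rightarrow> nat \<Rightarrow> bool"
  assumes "\<And>l N. \<exists>k>N. P l k"
  obtains \<tau> where "strict_mono \<tau>" "\<And>l. P l (\<tau> l)"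
proof -
  have "\<exists>\<tau>. \<forall>l. P l (\<tau> l) \<and> \<tau> l < \<tau> (Suc l)"
    by (rule dependent_nat_choice) (use assms in blast)+
  then show ?thesis
    using that by (auto simp: strict_mono_Suc_iff)
qed

text \<open>Rows are added as in the choice of a basis. If some combination of the new sequence with
  old rows returns infinitely often to one \<open>low N\<close>, it is constant on a subsequence,
  because \<open>low N\<close> is finite, and the new sequence is a constant plus old rows.
  Otherwise a thinned copy of the new sequence becomes one more row.\<close>

lemma escaping_subsequence:
  fixes f :: "nat \<Rightarrow> nat \<Rightarrow> bit poly"
  shows "\<exists>\<sigma> m g c J. strict_mono \<sigma> \<and> escaping m g \<and>
    (\<forall>i<n. J i \<subseteq> {..<m} \<and> (\<forall>l. f i (\<sigma> l) = c i + (\<Sum>j\<in>J i. g j l)))"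
proof (induction n)
  case 0
  show ?case
    by (intro exI[of _ id] exI[of _ 0]) (auto simp: escaping_def strict_mono_def)
next
  case (Suc n)
  then obtain \<sigma> m g c J where \<sigma>: "strict_mono \<sigma>" and g: "escaping m g"
    and eq: "\<And>i. i < n \<Longrightarrow> J i \<subseteq> {..<m}" "\<And>i l. i < n \<Longrightarrow> f i (\<sigma> l) = c i + (\<Sum>j\<in>J i. g j l)"
    by blast
  define h where "h I l = f n (\<sigma> l) + (\<Sum>j\<in>I. g j l)" for I l
  \<comment> \<open>Passing to a subsequence keeps an array escaping, because
    \<open>l \<le> \<tau> l\<close>.\<close>
  have g': "(\<Sum>j\<in>I. g j (\<tau> l)) \<notin> low l" if "strict_mono \<tau>" "I \<subseteq> {..<m}" "I \<noteq> {}" for \<tau> I l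
    using g that low_mono[of _ l "\<tau> l"] strict_mono_imp_increasing[of \<tau> l]
    by (auto simp: escaping_def)
  show ?case
  proof (cases "\<exists>I\<subseteq>{..<m}. \<exists>N. infinite {l. h I l \<in> low N}")
    case True
    then obtain I N where I: "I \<subseteq> {..<m}" and inf: "infinite {l. h I l \<in> low N}"
      by blast
    have "finite (h I ` {l. h I l \<in> low N})"
      by (rule finite_subset[OF _ finite_low[of N]]) auto
    from pigeonhole_infinite[OF inf this] obtain l0
      where "infinite {l \<in> {l. h I l \<in> low N}. h I l = h I l0}"
      by blast
    then have inf': "infinite {l. h I l = h I l0}"
      by (rule infinite_super[rotated]) auto
    define \<tau> where "\<tau> = enumerate {l. h I l = h I l0}"
    have \<tau>: "strict_mono \<tau>" "h I (\<tau> l) = h I l0" for l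
      using strict_mono_enumerate[OF inf'] enumerate_in_set[OF inf'] by (auto simp: \<tau>_def)
    have "f n (\<sigma> (\<tau> l)) = h I l0 + (\<Sum>j\<in>I. g j (\<tau> l))" for l
      using \<tau>(2)[of l] by (simp add: h_def[of I "\<tau> l"] add.assoc flip: \<tau>(2)[of l])
    then show ?thesis
      using strict_mono_compose[OF \<sigma> \<tau>(1)] I g'[OF \<tau>(1)] eq
      by (intro exI[of _ "\<lambda>l. \<sigma> (\<tau> l)"] exI[of _ m] exI[of _ "\<lambda>j l. g j (\<tau> l)"]
          exI[of _ "c(n := h I l0)"] exI[of _ "J(n := I)"])
        (auto simp: escaping_def less_Suc_eq)
  next
    case False
    have "\<exists>k>N. \<forall>I\<in>Pow {..<m}. h I k \<notin> low l" for l N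
    proof -
      \<comment> \<open>There are finitely many combinations \<open>I\<close>, and each is in
        \<open>low l\<close> only finitely often, so some late index avoids them all.\<close>
      have "finite ((\<Union>I\<in>Pow {..<m}. {k. h I k \<in> low l}) \<union> {..N})"
        using False by auto
      then obtain k where "k \<notin> (\<Union>I\<in>Pow {..<m}. {k. h I k \<in> low l}) \<union> {..N}"
        using ex_new_if_finite infinite_UNIV_nat by blast
      then show ?thesis
        by (intro exI[of _ k]) auto
    qed
    then obtain \<tau> where \<tau>: "strict_mono \<tau>" "\<And>l. \<forall>I\<in>Pow {..<m}. h I (\<tau> l) \<notin> low l"
      using strict_mono_choice[of "\<lambda>l k. \<forall>I\<in>Pow {..<m}. h I k \<notin> low l"] by blast
    define G where "G j l = (if j < m then g j (\<tau> l) else f n (\<sigma> (\<tau> l)))" for j l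
    have G: "(\<Sum>j\<in>I. G j l) = (\<Sum>j\<in>I. g j (\<tau> l))" if "I \<subseteq> {..<m}" for I l
      using that by (intro sum.cong) (auto simp: G_def)
    have "escaping (Suc m) G"
      unfolding escaping_def
    proof (intro allI impI)
      fix l I assume I: "I \<subseteq> {..<Suc m} \<and> I \<noteq> {}"
      show "(\<Sum>j\<in>I. G j l) \<notin> low l"
      proof (cases "m \<in> I")
        case True
        define I' where "I' = I - {m}"
        have I': "I' \<subseteq> {..<m}"
          using I by (auto simp: I'_def less_Suc_eq)
        have "finite I"
          using I finite_subset by blast
        then have "(\<Sum>j\<in>I. G j l) = G m l + (\<Sum>j\<in>I'. G j l)"
          unfolding I'_def using True by (rule sum.remove)
        also have "\<dots> = h I' (\<tau> l)"
          using G[OF I'] by (simp add: G_def h_def)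
        finally show ?thesis
          using \<tau>(2)[of l] I' by auto
      next
        case False
        then have "I \<subseteq> {..<m}"
          using I by (auto simp: less_Suc_eq)
        then show ?thesis
          using G g'[OF \<tau>(1)] I by auto
      qed
    qed
    moreover have "f i (\<sigma> (\<tau> l)) = c i + (\<Sum>j\<in>J i. G j l)" if "i < n" for i l
      using eq[OF that] G by simp
    moreover have "f n (\<sigma> (\<tau> l)) = (\<Sum>j\<in>{m}. G j l)" for l
      by (simp add: G_def)
    ultimately show ?thesis
      using strict_mono_compose[OF \<sigma> \<tau>(1)] eq(1)
      by (intro exI[of _ "\<lambda>l. \<sigma> (\<tau> l)"] exI[of _ "Suc m"] exI[of _ G]
          exI[of _ "c(n := 0)"] exI[of _ "J(n := {m})"])
        (fastforce simp: less_Suc_eq)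
  qed
qed


section \<open>Pointwise convergence with discrete values, on a set and on its powers\<close>

section \<open>Topologies of pointwise convergence\<close>

text \<open>This is the topology that \<open>v\<close> induces on \<open>C\<close> from a power of a
  discrete space; for injective \<open>v\<close> it makes \<open>C\<close> a space of
  functions.\<close>

definition pointwise_topology :: "'b set \<Rightarrow> ('b \<Rightarrow> 'k \<Rightarrow> 'v) \<Rightarrow> 'b topology" where
  "pointwise_topology C v = topology (\<lambda>U. U \<subseteq> C \<and>
     (\<forall>x\<in>U. \<exists>F. finite F \<and> {y\<in>C. \<forall>a\<in>F. v y a = v x a} \<subseteq> U))"

lemma openin_pointwise_topology:
  "openin (pointwise_topology C v) U \<longleftrightarrow>
     U \<subseteq> C \<and> (\<forall>x\<in>U. \<exists>F. finite F \<and> {y\<in>C. \<forall>a\<in>F. v y a = v x a} \<subseteq> U)"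
proof -
  have "istopology (\<lambda>U. U \<subseteq> C \<and> (\<forall>x\<in>U. \<exists>F. finite F \<and> {y\<in>C. \<forall>a\<in>F. v y a = v x a} \<subseteq> U))"
    unfolding istopology_def
  proof (intro conjI allI impI ballI, goal_cases)
    case (2 S U x)
    then obtain F where F: "finite F" "{y\<in>C. \<forall>a\<in>F. v y a = v x a} \<subseteq> S"
      by blast
    from 2 obtain F' where F': "finite F'" "{y\<in>C. \<forall>a\<in>F'. v y a = v x a} \<subseteq> U"
      by blast
    show ?case
      by (rule exI[of _ "F \<union> F'"]) (use F F' in auto)
  next
    case (4 K x)
    then obtain S where "S \<in> K" "x \<in> S"
      by blast
    with 4 obtain F where "finite F" "{y\<in>C. \<forall>a\<in>F. v y a = v x a} \<subseteq> S"
      by blast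
    with \<open>S \<in> K\<close> show ?case
      by blast
  qed blast+
  then show ?thesis
    by (simp add: pointwise_topology_def)
qed

lemma openin_pointwise_topology_basic:
  "finite F \<Longrightarrow> openin (pointwise_topology C v) {y\<in>C. \<forall>a\<in>F. v y a = w a}"
  unfolding openin_pointwise_topology by auto

lemma topspace_pointwise_topology [simp]: "topspace (pointwise_topology C v) = C"
proof (rule antisym)
  have "openin (pointwise_topology C v) C"
    using openin_pointwise_topology_basic[of "{}" C v] by simp
  then show "C \<subseteq> topspace (pointwise_topology C v)"
    by (rule openin_subset)
  show "topspace (pointwise_topology C v) \<subseteq> C"
    using openin_topspace[of "pointwise_topology C v"] unfolding openin_pointwise_topology by blast
qed

lemma Hausdorff_space_pointwise_topology:
  assumes "inj_on v C"
  shows "Hausdorff_space (pointwise_topology C v)"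
  unfolding Hausdorff_space_def
proof (intro allI impI)
  fix x y assume *: "x \<in> topspace (pointwise_topology C v) \<and> y \<in> topspace (pointwise_topology C v) \<and> x \<noteq> y"
  then have "v x \<noteq> v y"
    using assms by (auto simp: inj_on_def)
  then obtain a where a: "v x a \<noteq> v y a"
    by blast
  show "\<exists>U V. openin (pointwise_topology C v) U \<and> openin (pointwise_topology C v) V \<and>
          x \<in> U \<and> y \<in> V \<and> disjnt U V"
  proof (intro exI conjI)
    show "openin (pointwise_topology C v) {z\<in>C. \<forall>b\<in>{a}. v z b = v x b}"
      "openin (pointwise_topology C v) {z\<in>C. \<forall>b\<in>{a}. v z b = v y b}"
      by (rule openin_pointwise_topology_basic, simp)+
  qed (use * a in \<open>auto simp: disjnt_def\<close>)
qed

text \<open>An injective homomorphism into a Boolean group forces exponent two, so inversion is the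
  identity. A product agrees with \<open>x \<otimes> y\<close> on the tests in \<open>F\<close> as
  soon as its factors agree with \<open>x\<close> and \<open>y\<close> there.\<close>

lemma topological_group_pointwise_topology:
  fixes G (structure) and v :: "'b \<Rightarrow> 'k \<Rightarrow> 'v :: boolean_group"
  assumes G: "group G" and inj: "inj_on v (carrier G)"
    and mult: "\<And>x y. x \<in> carrier G \<Longrightarrow> y \<in> carrier G \<Longrightarrow> v (x \<otimes> y) = v x + v y"
  shows "topological_group G (pointwise_topology (carrier G) v)" (is "topological_group G ?T")
proof -
  interpret group G by (rule G)
  have inv: "inv x = x" if "x \<in> carrier G" for x
  proof -
    have "v (x \<otimes> x) = v (\<one> \<otimes> \<one>)"
      using that by (simp only: mult one_closed add_self)
    then have "x \<otimes> x = \<one> \<otimes> \<one>"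
      using inj that by (simp add: inj_on_eq_iff del: l_one r_one)
    then show ?thesis
      using that inv_equality by simp
  qed
  have "continuous_map (prod_topology ?T ?T) ?T (\<lambda>(x, y). x \<otimes> y)"
    unfolding continuous_map_def
  proof (intro conjI allI impI)
    show "(\<lambda>(x, y). x \<otimes> y) \<in> topspace (prod_topology ?T ?T) \<rightarrow> topspace ?T"
      by auto
    fix U assume U: "openin ?T U"
    show "openin (prod_topology ?T ?T) {z \<in> topspace (prod_topology ?T ?T). (case z of (x, y) \<Rightarrow> x \<otimes> y) \<in> U}"
      unfolding openin_prod_topology_alt
    proof (intro allI impI)
      fix x y assume "(x, y) \<in> {z \<in> topspace (prod_topology ?T ?T). (case z of (x, y) \<Rightarrow> x \<otimes> y) \<in> U}"
      then have xy: "x \<in> carrier G" "y \<in> carrier G" "x \<otimes> y \<in> U"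
        by auto
      with U obtain F where F: "finite F" "{z \<in> carrier G. \<forall>a\<in>F. v z a = v (x \<otimes> y) a} \<subseteq> U"
        unfolding openin_pointwise_topology by blast
      let ?B = "\<lambda>x. {z \<in> carrier G. \<forall>a\<in>F. v z a = v x a}"
      have "x' \<otimes> y' \<in> U" if "x' \<in> ?B x" "y' \<in> ?B y" for x' y'
        using that xy F(2) by (auto simp: mult)
      then show "\<exists>U' V'. openin ?T U' \<and> openin ?T V' \<and> x \<in> U' \<and> y \<in> V' \<and>
          U' \<times> V' \<subseteq> {z \<in> topspace (prod_topology ?T ?T). (case z of (x, y) \<Rightarrow> x \<otimes> y) \<in> U}"
        using xy openin_pointwise_topology_basic[OF F(1)]
        by (intro exI[of _ "?B x"] exI[of _ "?B y"]) auto
    qed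
  qed
  moreover have "continuous_map ?T ?T (\<lambda>x. inv x)"
    by (rule continuous_map_eq[OF continuous_map_id]) (simp add: inv)
  ultimately show ?thesis
    using G by (simp add: topological_group_def)
qed

lemma openin_product_pointwise_topology_basic:
  assumes "finite J" "J \<subseteq> I" "finite F"
  shows "openin (product_topology (\<lambda>_. pointwise_topology C v) I)
           {z \<in> I \<rightarrow>\<^sub>E C. \<forall>i\<in>J. \<forall>a\<in>F. v (z i) a = w i a}"
proof -
  let ?U = "\<lambda>i. if i \<in> J then {y\<in>C. \<forall>a\<in>F. v y a = w i a} else C"
  have "{z \<in> I \<rightarrow>\<^sub>E C. \<forall>i\<in>J. \<forall>a\<in>F. v (z i) a = w i a} = Pi\<^sub>E I ?U"
    using assms(2) by (auto simp: PiE_iff extensional_def split: if_splits)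
  moreover have "openin (product_topology (\<lambda>_. pointwise_topology C v) I) (Pi\<^sub>E I ?U)"
  proof (rule product_topology_basis)
    show "openin (pointwise_topology C v) (?U i)" for i
      using openin_pointwise_topology_basic[OF assms(3)] openin_topspace[of "pointwise_topology C v"]
      by auto
    show "finite {i. ?U i \<noteq> topspace (pointwise_topology C v)}"
      by (rule finite_subset[OF _ assms(1)]) auto
  qed
  ultimately show ?thesis
    by simp
qed

text \<open>The union of the finitely many test sets of the restricted coordinates serves all of
  them at once.\<close>

lemma openin_product_pointwise_topologyE:
  assumes "openin (product_topology (\<lambda>_. pointwise_topology C v) I) U" "x \<in> U"
  obtains J F where "finite J" "J \<subseteq> I" "finite F"
    "\<And>y. y \<in> I \<rightarrow>\<^sub>E C \<Longrightarrow> (\<And>i a. i \<in> J \<Longrightarrow> a \<in> F \<Longrightarrow> v (y i) a = v (x i) a) \<Longrightarrow> y \<in> U"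
proof -
  obtain W where W: "finite {i\<in>I. W i \<noteq> C}" "\<And>i. i \<in> I \<Longrightarrow> openin (pointwise_topology C v) (W i)"
    "x \<in> Pi\<^sub>E I W" "Pi\<^sub>E I W \<subseteq> U"
    using assms unfolding openin_product_topology_alt by (auto 0 3)
  have "\<forall>i\<in>I. \<exists>F. finite F \<and> {y\<in>C. \<forall>a\<in>F. v y a = v (x i) a} \<subseteq> W i"
    using W(2,3) unfolding openin_pointwise_topology by (auto simp: PiE_iff)
  from bchoice[OF this] obtain F where
    F: "\<And>i. i \<in> I \<Longrightarrow> finite (F i)" "\<And>i. i \<in> I \<Longrightarrow> {y\<in>C. \<forall>a\<in>F i. v y a = v (x i) a} \<subseteq> W i"
    by blast
  show ?thesis
  proof (rule that)
    show "finite {i\<in>I. W i \<noteq> C}" "{i\<in>I. W i \<noteq> C} \<subseteq> I" "finite (\<Union>i\<in>{i\<in>I. W i \<noteq> C}. F i)"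
      using W(1) F(1) by auto
    fix y assume y: "y \<in> I \<rightarrow>\<^sub>E C"
      and agree: "\<And>i a. i \<in> {i\<in>I. W i \<noteq> C} \<Longrightarrow> a \<in> (\<Union>i\<in>{i\<in>I. W i \<noteq> C}. F i) \<Longrightarrow> v (y i) a = v (x i) a"
    have "y i \<in> W i" if "i \<in> I" for i
    proof (cases "W i = C")
      case True
      then show ?thesis
        using y that by auto
    next
      case False
      then have "v (y i) a = v (x i) a" if "a \<in> F i" for a
        using \<open>i \<in> I\<close> that by (intro agree) auto
      moreover have "y i \<in> C"
        using y that by auto
      ultimately show ?thesis
        using F(2)[OF that] by blast
    qed
    then have "y \<in> Pi\<^sub>E I W"
      using y by (auto simp: PiE_iff)
    then show "y \<in> U"
      using W(4) by blast
  qed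
qed

text \<open>Together with the next lemma this turns density and accumulation into agreement at
  finitely many coordinates and finitely many tests.\<close>

lemma dense_product_pointwise_topology:
  fixes v :: "'b \<Rightarrow> 'k \<Rightarrow> 'v" and I :: "'i set"
  shows "product_topology (\<lambda>_. pointwise_topology C v) I closure_of D = I \<rightarrow>\<^sub>E C \<longleftrightarrow>
    (\<forall>x\<in>I \<rightarrow>\<^sub>E C. \<forall>J F. finite J \<longrightarrow> J \<subseteq> I \<longrightarrow> finite F \<longrightarrow>
      (\<exists>d\<in>D. d \<in> I \<rightarrow>\<^sub>E C \<and> (\<forall>i\<in>J. \<forall>a\<in>F. v (d i) a = v (x i) a)))"
    (is "?L = ?R")
proof -
  let ?P = "product_topology (\<lambda>_. pointwise_topology C v) I"
  have "?L \<longleftrightarrow> (\<forall>U. openin ?P U \<and> U \<noteq> {} \<longrightarrow> D \<inter> U \<noteq> {})"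
    using dense_intersects_open[of ?P D] by simp
  also have "\<dots> \<longleftrightarrow> ?R"
  proof (intro iffI ballI allI impI)
    fix x and J :: "'i set" and F :: "'k set" assume *: "\<forall>U. openin ?P U \<and> U \<noteq> {} \<longrightarrow> D \<inter> U \<noteq> {}"
      and x: "x \<in> I \<rightarrow>\<^sub>E C" and "finite J" "J \<subseteq> I" "finite F"
    then have "openin ?P {z \<in> I \<rightarrow>\<^sub>E C. \<forall>i\<in>J. \<forall>a\<in>F. v (z i) a = v (x i) a}"
      by (intro openin_product_pointwise_topology_basic)
    moreover have "x \<in> {z \<in> I \<rightarrow>\<^sub>E C. \<forall>i\<in>J. \<forall>a\<in>F. v (z i) a = v (x i) a}"
      using x by simp
    ultimately have "D \<inter> {z \<in> I \<rightarrow>\<^sub>E C. \<forall>i\<in>J. \<forall>a\<in>F. v (z i) a = v (x i) a} \<noteq> {}"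
      using *[rule_format, of "{z \<in> I \<rightarrow>\<^sub>E C. \<forall>i\<in>J. \<forall>a\<in>F. v (z i) a = v (x i) a}"] by blast
    then show "\<exists>d\<in>D. d \<in> I \<rightarrow>\<^sub>E C \<and> (\<forall>i\<in>J. \<forall>a\<in>F. v (d i) a = v (x i) a)"
      by blast
  next
    fix U assume R: ?R and U: "openin ?P U \<and> U \<noteq> {}"
    then obtain x where x: "x \<in> U"
      by blast
    then have "x \<in> I \<rightarrow>\<^sub>E C"
      using openin_subset[of ?P U] U by auto
    moreover obtain J F where "finite J" "J \<subseteq> I" "finite F"
      and JF: "\<And>y. y \<in> I \<rightarrow>\<^sub>E C \<Longrightarrow> (\<And>i a. i \<in> J \<Longrightarrow> a \<in> F \<Longrightarrow> v (y i) a = v (x i) a) \<Longrightarrow> y \<in> U"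
      using openin_product_pointwise_topologyE[OF conjunct1[OF U] x] by metis
    ultimately obtain d where d: "d \<in> D" "d \<in> I \<rightarrow>\<^sub>E C" "\<forall>i\<in>J. \<forall>a\<in>F. v (d i) a = v (x i) a"
      using R[rule_format, of x J F] by blast
    then have "d \<in> U"
      by (intro JF) auto
    with d(1) show "D \<inter> U \<noteq> {}"
      by blast
  qed
  finally show ?thesis .
qed

lemma derived_set_of_product_pointwise_topology:
  fixes v :: "'b \<Rightarrow> 'k \<Rightarrow> 'v" and I :: "'i set"
  assumes "inj_on v C"
  shows "x \<in> product_topology (\<lambda>_. pointwise_topology C v) I derived_set_of S \<longleftrightarrow>
    x \<in> I \<rightarrow>\<^sub>E C \<and> (\<forall>J F. finite J \<longrightarrow> J \<subseteq> I \<longrightarrow> finite F \<longrightarrow>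
      infinite {d\<in>S. d \<in> I \<rightarrow>\<^sub>E C \<and> (\<forall>i\<in>J. \<forall>a\<in>F. v (d i) a = v (x i) a)})"
    (is "?L = ?R")
proof -
  let ?P = "product_topology (\<lambda>_. pointwise_topology C v) I"
  have "Hausdorff_space ?P"
    using Hausdorff_space_pointwise_topology[OF assms] by (simp add: Hausdorff_space_product_topology)
  then have "?L \<longleftrightarrow> x \<in> I \<rightarrow>\<^sub>E C \<and> (\<forall>U. x \<in> U \<and> openin ?P U \<longrightarrow> infinite (S \<inter> U))"
    by (simp add: derived_set_of_infinite_openin)
  also have "\<dots> \<longleftrightarrow> ?R"
  proof (intro iffI conjI allI impI; elim conjE)
    fix J :: "'i set" and F :: "'k set" assume *: "\<forall>U. x \<in> U \<and> openin ?P U \<longrightarrow> infinite (S \<inter> U)"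
      and x: "x \<in> I \<rightarrow>\<^sub>E C" and "finite J" "J \<subseteq> I" "finite F"
    then have "openin ?P {z \<in> I \<rightarrow>\<^sub>E C. \<forall>i\<in>J. \<forall>a\<in>F. v (z i) a = v (x i) a}"
      by (intro openin_product_pointwise_topology_basic)
    moreover have "x \<in> {z \<in> I \<rightarrow>\<^sub>E C. \<forall>i\<in>J. \<forall>a\<in>F. v (z i) a = v (x i) a}"
      using x by simp
    ultimately have "infinite (S \<inter> {z \<in> I \<rightarrow>\<^sub>E C. \<forall>i\<in>J. \<forall>a\<in>F. v (z i) a = v (x i) a})"
      using *[rule_format, of "{z \<in> I \<rightarrow>\<^sub>E C. \<forall>i\<in>J. \<forall>a\<in>F. v (z i) a = v (x i) a}"] by blast
    also have "S \<inter> {z \<in> I \<rightarrow>\<^sub>E C. \<forall>i\<in>J. \<forall>a\<in>F. v (z i) a = v (x i) a} =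
        {d\<in>S. d \<in> I \<rightarrow>\<^sub>E C \<and> (\<forall>i\<in>J. \<forall>a\<in>F. v (d i) a = v (x i) a)}"
      by blast
    finally show "infinite {d\<in>S. d \<in> I \<rightarrow>\<^sub>E C \<and> (\<forall>i\<in>J. \<forall>a\<in>F. v (d i) a = v (x i) a)}" .
  next
    fix U assume R: "\<forall>J F. finite J \<longrightarrow> J \<subseteq> I \<longrightarrow> finite F \<longrightarrow>
        infinite {d\<in>S. d \<in> I \<rightarrow>\<^sub>E C \<and> (\<forall>i\<in>J. \<forall>a\<in>F. v (d i) a = v (x i) a)}"
      and U: "x \<in> U" "openin ?P U"
    obtain J F where JF: "finite J" "J \<subseteq> I" "finite F"
      "\<And>y. y \<in> I \<rightarrow>\<^sub>E C \<Longrightarrow> (\<And>i a. i \<in> J \<Longrightarrow> a \<in> F \<Longrightarrow> v (y i) a = v (x i) a) \<Longrightarrow> y \<in> U"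
      using openin_product_pointwise_topologyE[OF U(2,1)] by metis
    then have "infinite {d\<in>S. d \<in> I \<rightarrow>\<^sub>E C \<and> (\<forall>i\<in>J. \<forall>a\<in>F. v (d i) a = v (x i) a)}"
      by (intro R[rule_format])
    moreover have "{d\<in>S. d \<in> I \<rightarrow>\<^sub>E C \<and> (\<forall>i\<in>J. \<forall>a\<in>F. v (d i) a = v (x i) a)} \<subseteq> S \<inter> U"
      using JF(4) by blast
    ultimately show "infinite (S \<inter> U)"
      using infinite_super by blast
  qed
  finally show ?thesis .
qed


section \<open>Limits of array rows inside the Bohr compactification, and the group they
  generate\<close>

section \<open>The group generated by limits along selective ultrafilters\<close>

text \<open>The injection \<open>code\<close> only moves the group of functionals to a carrier of the required type.
A function \<open>A :: nat \<Rightarrow> bit\<close> stands for the character of \<open>bit poly\<close> that takes the value \<open>A i\<close> at \<open>X ^ i\<close>.\<close>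

locale selective_limits =
  fixes p :: "'s \<Rightarrow> nat set set"
    and m :: "'s \<Rightarrow> nat"
    and g :: "'s \<Rightarrow> nat \<Rightarrow> nat \<Rightarrow> bit poly"
    and code :: "((nat \<Rightarrow> bit) \<Rightarrow> bit) \<Rightarrow> 'b"
  assumes selective: "\<And>s. selective_ultrafilter (p s)"
    and incomparable: "\<And>s t. s \<noteq> t \<Longrightarrow> \<not> rk_le (p s) (p t)"
    and escaping: "\<And>s. escaping (m s) (g s)"
    and exhaustive: "\<And>n f. escaping n f \<Longrightarrow> \<exists>s. m s = n \<and> (\<forall>j<n. \<forall>l. g s j l = f j l)"
    and inj_code: "inj code"
begin

lemma free: "free_ultrafilter_nat (p s)"
  using selective by (simp add: selective_ultrafilter_def)

lemma nonempty: "A \<in> p s \<Longrightarrow> A \<noteq> {}"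
  using free_ultrafilter_natD(2)[OF free] by blast

definition indices :: "('s \<times> nat) set" where
  "indices = {t. snd t < m (fst t)}"

definition gen :: "'s \<times> nat \<Rightarrow> nat \<Rightarrow> bit poly" where
  "gen t = g (fst t) (snd t)"

text \<open>The limit of the row \<open>gen t\<close> along its ultrafilter, taken separately on
  each character \<open>A\<close>: one of the two values prevails.\<close>

definition plim :: "'s \<times> nat \<Rightarrow> (nat \<Rightarrow> bit) \<Rightarrow> bit" where
  "plim t A = (if {l. pairing A (gen t l) = 1} \<in> p (fst t) then 1 else 0)"

text \<open>A general element of the group: a polynomial plus a finite set \<open>w\<close> of new
  generators, seen as a functional on characters.\<close>

definition ev :: "bit poly \<Rightarrow> ('s \<times> nat) set \<Rightarrow> (nat \<Rightarrow> bit) \<Rightarrow> bit" where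
  "ev h w A = pairing A h + (\<Sum>t\<in>w. plim t A)"

definition elements :: "'b set" where
  "elements = {code (ev h w) | h w. finite w \<and> w \<subseteq> indices}"

definition val :: "'b \<Rightarrow> (nat \<Rightarrow> bit) \<Rightarrow> bit" where
  "val = inv_into UNIV code"

definition limit_topology :: "'b topology" where
  "limit_topology = pointwise_topology elements val"

definition limit_group :: "'b monoid" where
  "limit_group = \<lparr>carrier = elements, monoid.mult = (\<lambda>x y. code (val x + val y)), one = code 0\<rparr>"

lemma val_code [simp]: "val (code z) = z"
  by (simp add: val_def inj_code)

lemma inj_on_val: "inj_on val elements"
  by (rule inj_onI) (auto simp: elements_def)

lemma elementsE:
  assumes "x \<in> elements"
  obtains h w where "finite w" "w \<subseteq> indices" "x = code (ev h w)"
  using assms unfolding elements_def by blast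

lemma code_ev_in_elements: "finite w \<Longrightarrow> w \<subseteq> indices \<Longrightarrow> code (ev h w) \<in> elements"
  unfolding elements_def by blast

lemma ev_add:
  assumes "finite w" "finite w'"
  shows "ev h w + ev h' w' = ev (h + h') (sym_diff w w')"
proof
  fix A
  show "(ev h w + ev h' w') A = ev (h + h') (sym_diff w w') A"
    unfolding plus_fun_apply ev_def pairing_add sum_sym_diff[OF assms] by (simp only: ac_simps)
qed

lemma ev_zero: "ev 0 {} = 0"
  by (auto simp: ev_def)

lemma pairing_indicator: "pairing (\<lambda>j. of_bool (j = i)) h = coeff h i"
proof -
  have "pairing (\<lambda>j. of_bool (j = i)) h = (\<Sum>j\<le>max (degree h) i. coeff h j * of_bool (j = i))"
    by (rule pairing_eq) simp
  also have "\<dots> = (\<Sum>j\<le>max (degree h) i. if j = i then coeff h j else 0)"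
    by (rule sum.cong) auto
  also have "\<dots> = coeff h i"
    by (subst sum.delta) auto
  finally show ?thesis .
qed

lemma ev_inject: "ev h {} = ev h' {} \<longleftrightarrow> h = h'"
proof
  assume "ev h {} = ev h' {}"
  then have "pairing A h = pairing A h'" for A
    by (auto simp: ev_def dest: fun_cong[of _ _ A])
  then have "coeff h i = coeff h' i" for i
    by (metis pairing_indicator)
  then show "h = h'"
    by (simp add: poly_eq_iff)
qed simp

lemma plim_mem: "{l. pairing A (gen t l) = plim t A} \<in> p (fst t)"
proof (cases "{l. pairing A (gen t l) = 1} \<in> p (fst t)")
  case True
  then show ?thesis
    by (simp add: plim_def)
next
  case False
  then have "- {l. pairing A (gen t l) = 1} \<in> p (fst t)"
    by (rule free_ultrafilter_natD(5)[OF free])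
  also have "- {l. pairing A (gen t l) = 1} = {l. pairing A (gen t l) = plim t A}"
    using False by (auto simp: plim_def)
  finally show ?thesis .
qed

lemma plim_eqI:
  assumes "B \<in> p (fst t)" "\<And>l. l \<in> B \<Longrightarrow> pairing A (gen t l) = c"
  shows "plim t A = c"
proof -
  have "B \<inter> {l. pairing A (gen t l) = plim t A} \<in> p (fst t)"
    by (rule free_ultrafilter_natD(3)[OF free assms(1) plim_mem])
  then have "B \<inter> {l. pairing A (gen t l) = plim t A} \<noteq> {}"
    by (rule nonempty)
  then show ?thesis
    using assms(2) by auto
qed

text \<open>This is the density of the polynomials in the group: on finitely many characters, each
  generator in \<open>w\<close> can be replaced by one entry of its row.\<close>

lemma ev_approximable:
  assumes "finite w" "finite F"
  shows "\<exists>h'. \<forall>A\<in>F. pairing A h' = ev h w A"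
  using assms(1)
proof (induction w rule: finite_induct)
  case empty
  show ?case
    by (rule exI[of _ h]) (simp add: ev_def)
next
  case (insert t w)
  then obtain h' where h': "\<And>A. A \<in> F \<Longrightarrow> pairing A h' = ev h w A"
    by blast
  have "(\<Inter>A\<in>F. {l. pairing A (gen t l) = plim t A}) \<in> p (fst t)"
    by (rule free_ultrafilter_nat_INT[OF free assms(2) plim_mem])
  then obtain l where "l \<in> (\<Inter>A\<in>F. {l. pairing A (gen t l) = plim t A})"
    using nonempty by blast
  then have "pairing A (gen t l + h') = ev h (insert t w) A" if "A \<in> F" for A
    using that h' insert.hyps by (simp add: pairing_add ev_def ac_simps)
  then show ?case
    by blast
qed

lemma group_limit_group: "group limit_group"
proof (rule groupI)
  fix x y assume x: "x \<in> carrier limit_group" and y: "y \<in> carrier limit_group"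
  obtain h w where hw: "finite w" "w \<subseteq> indices" "x = code (ev h w)"
    using x by (auto simp: limit_group_def elim: elementsE)
  obtain h' w' where hw': "finite w'" "w' \<subseteq> indices" "y = code (ev h' w')"
    using y by (auto simp: limit_group_def elim: elementsE)
  have "code (ev (h + h') (sym_diff w w')) \<in> elements"
    using hw hw' by (intro code_ev_in_elements) auto
  then show "x \<otimes>\<^bsub>limit_group\<^esub> y \<in> carrier limit_group"
    using hw hw' by (simp add: limit_group_def ev_add)
next
  show "\<one>\<^bsub>limit_group\<^esub> \<in> carrier limit_group"
    using code_ev_in_elements[of "{}" 0] by (simp add: limit_group_def ev_zero)
next
  fix x y z
  show "x \<otimes>\<^bsub>limit_group\<^esub> y \<otimes>\<^bsub>limit_group\<^esub> z = x \<otimes>\<^bsub>limit_group\<^esub> (y \<otimes>\<^bsub>limit_group\<^esub> z)"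
    by (simp add: limit_group_def add.assoc)
next
  fix x assume "x \<in> carrier limit_group"
  then show "\<one>\<^bsub>limit_group\<^esub> \<otimes>\<^bsub>limit_group\<^esub> x = x"
    by (auto simp: limit_group_def elim: elementsE)
next
  fix x assume "x \<in> carrier limit_group"
  then show "\<exists>y\<in>carrier limit_group. y \<otimes>\<^bsub>limit_group\<^esub> x = \<one>\<^bsub>limit_group\<^esub>"
    by (intro bexI[of _ x]) (simp_all add: limit_group_def)
qed

lemma topological_group_limit_group: "topological_group limit_group limit_topology"
  using topological_group_pointwise_topology[OF group_limit_group, of val] inj_on_val
  by (simp add: limit_topology_def limit_group_def)

lemma Hausdorff_space_limit_topology: "Hausdorff_space limit_topology"
  unfolding limit_topology_def by (rule Hausdorff_space_pointwise_topology[OF inj_on_val])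

section \<open>Accumulation points in finite powers\<close>

section \<open>Finite powers\<close>

lemma countably_pracompact_finite_power:
  fixes n :: nat
  shows "countably_pracompact (product_topology (\<lambda>_. limit_topology) {..<n})" (is "countably_pracompact ?P")
proof -
  define D where "D = {..<n} \<rightarrow>\<^sub>E range (\<lambda>h. code (ev h {}))"
  have D: "D \<subseteq> {..<n} \<rightarrow>\<^sub>E elements"
    unfolding D_def by (rule PiE_mono) (auto intro: code_ev_in_elements)
  have dense: "?P closure_of D = topspace ?P"
  proof -
    have "\<exists>d\<in>D. d \<in> {..<n} \<rightarrow>\<^sub>E elements \<and> (\<forall>i\<in>J. \<forall>A\<in>F. val (d i) A = val (x i) A)"
      if x: "x \<in> {..<n} \<rightarrow>\<^sub>E elements" and J: "J \<subseteq> {..<n}" and F: "finite F" for x J F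
    proof -
      have "\<exists>h. \<forall>A\<in>F. pairing A h = val (x i) A" if "i < n" for i
      proof -
        have "x i \<in> elements"
          using x that by auto
        then obtain h w where "finite w" "w \<subseteq> indices" "x i = code (ev h w)"
          by (rule elementsE)
        then show ?thesis
          using ev_approximable[OF _ F] by simp
      qed
      then obtain h where h: "\<And>i A. i < n \<Longrightarrow> A \<in> F \<Longrightarrow> pairing A (h i) = val (x i) A"
        by metis
      define d where "d = (\<lambda>i\<in>{..<n}. code (ev (h i) {}))"
      have "d \<in> D"
        by (auto simp: D_def d_def)
      moreover have "\<forall>i\<in>J. \<forall>A\<in>F. val (d i) A = val (x i) A"
        using J h by (auto simp: d_def ev_def)
      ultimately show ?thesis
        using D by blast
    qed
    then show ?thesis
      using dense_product_pointwise_topology[of elements val "{..<n}" D] by (simp add: limit_topology_def)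
  qed
  have "?P derived_set_of S \<noteq> {}" if S: "S \<subseteq> D" "infinite S" for S
  proof -
    obtain e :: "nat \<Rightarrow> nat \<Rightarrow> 'b" where e: "inj e" "range e \<subseteq> S"
      using infinite_countable_subset[OF S(2)] by blast
    have "\<exists>h. e k i = code (ev h {})" if "i < n" for k i
    proof -
      have "e k \<in> D"
        using e(2) S(1) by blast
      then show ?thesis
        using that by (auto simp: D_def PiE_iff)
    qed
    then obtain f where f: "\<And>k i. i < n \<Longrightarrow> e k i = code (ev (f i k) {})"
      by metis
    obtain \<sigma> q u c J where \<sigma>: "strict_mono \<sigma>" and esc: "escaping q u"
      and J: "\<And>i. i < n \<Longrightarrow> J i \<subseteq> {..<q}" "\<And>i l. i < n \<Longrightarrow> f i (\<sigma> l) = c i + (\<Sum>j\<in>J i. u j l)"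
      using escaping_subsequence[of n f] by blast
    obtain s where s: "m s = q" "\<And>j l. j < q \<Longrightarrow> g s j l = u j l"
      using exhaustive[OF esc] by blast
    \<comment> \<open>The candidate for the accumulation point replaces each row of the array by its
      limit along \<open>p s\<close>.\<close>
    define y where "y = (\<lambda>i\<in>{..<n}. code (ev (c i) (Pair s ` J i)))"
    have fin: "finite (J i)" if "i < n" for i
      using J(1)[OF that] finite_subset by blast
    have y: "y \<in> {..<n} \<rightarrow>\<^sub>E elements"
    proof -
      have "code (ev (c i) (Pair s ` J i)) \<in> elements" if "i < n" for i
        using J(1)[OF that] s(1) fin[OF that] by (intro code_ev_in_elements) (auto simp: indices_def)
      then show ?thesis
        by (auto simp: y_def)
    qed
    have "infinite {d\<in>S. d \<in> {..<n} \<rightarrow>\<^sub>E elements \<and> (\<forall>i\<in>I. \<forall>A\<in>F. val (d i) A = val (y i) A)}" (is "infinite ?N")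
      if I: "I \<subseteq> {..<n}" and F: "finite F" for I F
    proof -
      \<comment> \<open>These are the columns in which every row agrees with its limit on all of
        \<open>F\<close>. As a member of a free ultrafilter \<open>B\<close> is infinite, and each
        of its columns yields a point of \<open>S\<close> near \<open>y\<close>.\<close>
      define B where "B = (\<Inter>j\<in>{..<q}. \<Inter>A\<in>F. {l. pairing A (gen (s, j) l) = plim (s, j) A})"
      have "B \<in> p s"
        unfolding B_def
      proof (intro free_ultrafilter_nat_INT free F)
        show "{l. pairing A (gen (s, j) l) = plim (s, j) A} \<in> p s" for A j
          using plim_mem[of A "(s, j)"] by simp
      qed simp
      then have "infinite B"
        using free_ultrafilter_natD(6)[OF free] by blast
      moreover have "inj_on (\<lambda>l. e (\<sigma> l)) B"
        using e(1) strict_mono_imp_inj_on[OF \<sigma>] by (auto simp: inj_on_def)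
      ultimately have "infinite ((\<lambda>l. e (\<sigma> l)) ` B)"
        using finite_imageD by blast
      moreover have "e (\<sigma> l) \<in> ?N" if l: "l \<in> B" for l
      proof -
        have "val (e (\<sigma> l) i) A = val (y i) A" if "i \<in> I" "A \<in> F" for i A
        proof -
          have i: "i < n"
            using that I by auto
          have "val (e (\<sigma> l) i) A = pairing A (c i) + (\<Sum>j\<in>J i. pairing A (u j l))"
            using i by (simp add: f J(2) ev_def pairing_add pairing_sum)
          also have "(\<Sum>j\<in>J i. pairing A (u j l)) = (\<Sum>j\<in>J i. plim (s, j) A)"
          proof (rule sum.cong)
            fix j assume "j \<in> J i"
            then have "j < q"
              using J(1)[OF i] by auto
            then show "pairing A (u j l) = plim (s, j) A"
              using l that s(2) by (auto simp: B_def gen_def)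
          qed simp
          also have "\<dots> = (\<Sum>t\<in>Pair s ` J i. plim t A)"
            by (simp add: sum.reindex inj_on_def)
          finally show ?thesis
            using i by (simp add: y_def ev_def)
        qed
        moreover have "e (\<sigma> l) \<in> S"
          using e(2) by auto
        ultimately show ?thesis
          using S(1) D by blast
      qed
      ultimately show ?thesis
        using finite_subset[of "(\<lambda>l. e (\<sigma> l)) ` B" ?N] by blast
    qed
    then have "y \<in> ?P derived_set_of S"
      using y derived_set_of_product_pointwise_topology[OF inj_on_val, of y "{..<n}" S] by (simp add: limit_topology_def)
    then show ?thesis
      by blast
  qed
  with D dense show ?thesis
    unfolding countably_pracompact_def by (intro exI[of _ D]) (auto simp: limit_topology_def)
qed


section \<open>Linear systems for characters with prescribed limits\<close>

section \<open>Characters separating a sequence from a point\<close>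

text \<open>The unknown is a character of the product of the polynomial group with a group of formal
  generators. Homogeneous equations make the entries of row \<open>t\<close> along
  \<open>B t\<close> agree with the formal generator \<open>t\<close>, which fixes
  \<open>plim t\<close>; one inhomogeneous equation for each \<open>k\<close> in \<open>Q\<close>
  makes the two values differ. The assumption \<open>indep\<close> excludes every vanishing
  combination that contains an inhomogeneous equation.\<close>

lemma ev_separate:
  fixes uh :: "nat \<Rightarrow> bit poly" and uw :: "nat \<Rightarrow> ('s \<times> nat) set"
  assumes B: "\<And>t. t \<in> T \<Longrightarrow> B t \<in> p (fst t)"
    and uw: "\<And>k. k \<in> Q \<Longrightarrow> finite (uw k)" "\<And>k. k \<in> Q \<Longrightarrow> uw k \<subseteq> T"
    and w: "finite w" "w \<subseteq> T"
    and indep: "\<And>Z Y. finite Z \<Longrightarrow> Z \<subseteq> Q \<Longrightarrow> Z \<noteq> {} \<Longrightarrow> finite Y \<Longrightarrow> Y \<subseteq> Sigma T B \<Longrightarrow>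
      (\<Sum>k\<in>Z. uh k + h) = (\<Sum>y\<in>Y. gen (fst y) (snd y)) \<Longrightarrow>
      (\<And>t. (\<Sum>k\<in>Z. of_bool (t \<in> uw k) + of_bool (t \<in> w)) = (\<Sum>y\<in>Y. of_bool (t = fst y) :: bit)) \<Longrightarrow> False"
  shows "\<exists>A. \<forall>k\<in>Q. ev (uh k) (uw k) A \<noteq> ev h w A"
proof -
  define ind :: "('s \<times> nat) set \<Rightarrow> ('s \<times> nat) \<Rightarrow> bit" where "ind w t = of_bool (t \<in> w)" for w t
  define f where "f = case_sum (\<lambda>y. (gen (fst y) (snd y), ind {fst y})) (\<lambda>k. (uh k + h, ind (uw k) + ind w))"
  define c :: "(('s \<times> nat) \<times> nat) + nat \<Rightarrow> bit" where "c = case_sum (\<lambda>_. 0) (\<lambda>_. 1)"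
  obtain \<psi> :: "bit poly \<times> ('s \<times> nat \<Rightarrow> bit) \<Rightarrow> bit"
    where \<psi>: "Modules.additive \<psi>" "\<And>i. i \<in> Sigma T B <+> Q \<Longrightarrow> \<psi> (f i) = c i"
  proof (rule additive_system_solvable[of "Sigma T B <+> Q" f c])
    fix X assume X: "finite X" "X \<subseteq> Sigma T B <+> Q" "(\<Sum>i\<in>X. f i) = 0"
    define Y Z where "Y = Inl -` X" and "Z = Inr -` X"
    have "x \<in> X \<longleftrightarrow> x \<in> Y <+> Z" for x
      by (cases x) (auto simp: Y_def Z_def)
    then have XYZ: "X = Y <+> Z"
      by blast
    have fin: "finite Y" "finite Z" and sub: "Y \<subseteq> Sigma T B" "Z \<subseteq> Q"
      using X(1,2) by (auto simp: Y_def Z_def finite_vimageI)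
    \<comment> \<open>Only equations from \<open>Q\<close> have right-hand side one, so consistency
      follows once none of them occurs.\<close>
    have "Z = {}"
    proof (rule ccontr)
      assume "Z \<noteq> {}"
      have "(\<Sum>y\<in>Y. f (Inl y)) + (\<Sum>k\<in>Z. f (Inr k)) = 0"
        using X(3) fin by (simp add: XYZ sum.Plus)
      then have eq: "(\<Sum>y\<in>Y. f (Inl y)) = (\<Sum>k\<in>Z. f (Inr k))"
        by (simp only: add_eq_zero_iff)
      have "(\<Sum>k\<in>Z. uh k + h) = (\<Sum>y\<in>Y. gen (fst y) (snd y))"
        using arg_cong[where f = fst, OF eq] by (simp add: fst_sum f_def)
      moreover have "(\<Sum>k\<in>Z. of_bool (t \<in> uw k) + of_bool (t \<in> w)) = (\<Sum>y\<in>Y. of_bool (t = fst y) :: bit)" for t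
      proof -
        have sum_apply: "(\<Sum>i\<in>I. F i) t = (\<Sum>i\<in>I. F i t)" for I :: "'i set" and F :: "'i \<Rightarrow> ('s \<times> nat) \<Rightarrow> bit"
          by (induction I rule: infinite_finite_induct) auto
        have "(\<Sum>y\<in>Y. snd (f (Inl y))) t = (\<Sum>k\<in>Z. snd (f (Inr k))) t"
          using arg_cong[where f = snd, OF eq] by (simp add: snd_sum)
        then show ?thesis
          unfolding sum_apply by (simp add: f_def ind_def)
      qed
      ultimately show False
        using indep[OF fin(2) sub(2) \<open>Z \<noteq> {}\<close> fin(1) sub(1)] by blast
    qed
    then show "(\<Sum>i\<in>X. c i) = 0"
      using fin by (simp add: XYZ sum.Plus c_def)
  qed blast
  define A where "A i = \<psi> (monom 1 i, 0)" for i
  note add = Modules.additive.add[OF \<psi>(1)]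
  have additive: "Modules.additive (\<lambda>x. \<psi> (x, 0))" "Modules.additive (\<lambda>x. \<psi> (0, x))"
    using add[of "(_, 0)" "(_, 0)"] add[of "(0, _)" "(0, _)"] by (auto intro!: Modules.additive.intro)
  have pairing: "pairing A x = \<psi> (x, 0)" for x
    unfolding A_def by (rule pairing_additive[OF additive(1)])
  have split: "\<psi> (x, y) = \<psi> (x, 0) + \<psi> (0, y)" for x y
    using add[of "(x, 0)" "(0, y)"] by simp
  have lim: "plim t A = \<psi> (0, ind {t})" if t: "t \<in> T" for t
  proof (rule plim_eqI[OF B[OF t]])
    fix l assume "l \<in> B t"
    then have "Inl (t, l) \<in> Sigma T B <+> Q"
      using t by auto
    from \<psi>(2)[OF this] have "\<psi> (gen t l, ind {t}) = 0"
      by (simp add: f_def c_def)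
    then show "pairing A (gen t l) = \<psi> (0, ind {t})"
      using split[of "gen t l" "ind {t}"] by (metis add_eq_zero_iff pairing)
  qed
  have ev: "ev x v A = \<psi> (x, ind v)" if v: "finite v" "v \<subseteq> T" for x v
  proof -
    have "ind v = (\<Sum>t\<in>v. ind {t})"
      using v(1)
    proof (induction v rule: finite_induct)
      case (insert t v)
      have "ind (insert t v) = ind {t} + ind v"
        using insert.hyps(2) by (auto simp: ind_def fun_eq_iff)
      also have "\<dots> = (\<Sum>t\<in>insert t v. ind {t})"
        using insert.hyps by (simp flip: insert.IH)
      finally show ?case .
    qed (simp add: ind_def fun_eq_iff)
    then have "\<psi> (0, ind v) = (\<Sum>t\<in>v. \<psi> (0, ind {t}))"
      using Modules.additive.sum[OF additive(2)] by metis
    also have "\<dots> = (\<Sum>t\<in>v. plim t A)"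
      using v(2) lim by (intro sum.cong) auto
    finally show ?thesis
      using split[of x "ind v"] by (metis ev_def pairing)
  qed
  have "ev (uh k) (uw k) A \<noteq> ev h w A" if k: "k \<in> Q" for k
  proof -
    have "\<psi> (uh k, ind (uw k)) + \<psi> (h, ind w) = \<psi> (f (Inr k))"
      using add[of "(uh k, ind (uw k))" "(h, ind w)"] by (simp add: f_def)
    also have "\<dots> = 1"
      using \<psi>(2)[OF InrI[OF k]] by (simp add: c_def)
    finally show ?thesis
      using ev[OF w] ev[OF uw(1)[OF k] uw(2)[OF k]] by auto
  qed
  then show ?thesis
    by blast
qed

definition sparse :: "'s set \<Rightarrow> ('s \<Rightarrow> nat \<Rightarrow> nat) \<Rightarrow> ('s \<Rightarrow> nat set) \<Rightarrow> bool" where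
  "sparse S K A \<longleftrightarrow>
    (\<forall>s\<in>S. \<forall>t\<in>S. \<forall>l\<in>A s. \<forall>l'\<in>A t. l < l' \<longrightarrow> K s l < l') \<and>
    (\<forall>s\<in>S. \<forall>t\<in>S. s \<noteq> t \<longrightarrow> A s \<inter> A t = {})"

lemma sparseE:
  assumes "countable S"
  obtains A where "sparse S K A" "\<And>s. s \<in> S \<Longrightarrow> A s \<in> p s"
proof -
  obtain A where "\<And>s. s \<in> S \<Longrightarrow> A s \<in> p s"
    "\<And>s t l l'. s \<in> S \<Longrightarrow> t \<in> S \<Longrightarrow> l \<in> A s \<Longrightarrow> l' \<in> A t \<Longrightarrow> l < l' \<Longrightarrow> K s l < l'"
    "\<And>s t. s \<in> S \<Longrightarrow> t \<in> S \<Longrightarrow> s \<noteq> t \<Longrightarrow> A s \<inter> A t = {}"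
    by (rule selective_ultrafilters_sparse[of S p K]) (use selective incomparable assms in auto)
  then show ?thesis
    using that[of A] unfolding sparse_def by blast
qed

definition bound :: "'s \<Rightarrow> nat \<Rightarrow> nat" where
  "bound s l = (SOME N. (\<lambda>j. g s j l) ` {..<m s} \<subseteq> low N)"

lemma gen_in_low_bound:
  assumes "t \<in> indices"
  shows "gen t l \<in> low (bound (fst t) l)"
proof -
  have "\<exists>N. (\<lambda>j. g s j l) ` {..<m s} \<subseteq> low N" for s
    using finite_imp_low[of "(\<lambda>j. g s j l) ` {..<m s}" 0] by blast
  then have "(\<lambda>j. g (fst t) j l) ` {..<m (fst t)} \<subseteq> low (bound (fst t) l)"
    unfolding bound_def by (rule someI_ex)
  then show ?thesis
    using assms by (auto simp: gen_def indices_def)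
qed

text \<open>Let \<open>L\<close> be the largest index in \<open>Y\<close>. By disjointness all terms
  at \<open>L\<close> come from one array, so they form a nonempty combination of its column
  \<open>L\<close> and are outside \<open>low L\<close> by escaping. By sparsity all earlier terms
  are in \<open>low L\<close> and cannot compensate.\<close>

lemma sparse_sum_not_low:
  assumes sparse: "sparse S K A"
    and K: "\<And>t l. t \<in> indices \<Longrightarrow> gen t l \<in> low (K (fst t) l)"
    and Y: "finite Y" "\<And>t l. (t, l) \<in> Y \<Longrightarrow> t \<in> indices \<and> fst t \<in> S \<and> l \<in> A (fst t)"
    and tl: "(t, l) \<in> Y"
  shows "(\<Sum>y\<in>Y. gen (fst y) (snd y)) \<notin> low l"
proof -
  define L where "L = Max (snd ` Y)"
  have L: "l' \<le> L" if "(t', l') \<in> Y" for t' l'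
    using that Y(1) unfolding L_def by (intro Max_ge) force+
  have "L \<in> snd ` Y"
    unfolding L_def using Y(1) tl by (intro Max_in) auto
  then obtain s j where sj: "((s, j), L) \<in> Y"
    by auto
  define J where "J = {j. ((s, j), L) \<in> Y}"
  have "y \<in> (\<lambda>j. ((s, j), L)) ` J" if y: "y \<in> Y" "snd y = L" for y
  proof -
    obtain s' j' where y': "y = ((s', j'), L)"
      using y(2) by (metis prod.collapse)
    have "s' = s"
    proof (rule ccontr)
      assume "s' \<noteq> s"
      moreover have "s \<in> S" "L \<in> A s" "s' \<in> S" "L \<in> A s'"
        using Y(2)[OF sj] Y(2)[of "(s', j')" L] y(1) y' by auto
      ultimately show False
        using sparse unfolding sparse_def by blast
    qed
    then show ?thesis
      using y(1) y' by (auto simp: J_def)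
  qed
  then have top: "{y\<in>Y. snd y = L} = (\<lambda>j. ((s, j), L)) ` J"
    by (auto simp: J_def)
  have "(\<Sum>y\<in>{y\<in>Y. snd y = L}. gen (fst y) (snd y)) = (\<Sum>j\<in>J. g s j L)"
    unfolding top by (simp add: sum.reindex inj_on_def gen_def)
  moreover have "J \<subseteq> {..<m s}" "J \<noteq> {}"
    using Y(2) sj by (auto simp: J_def indices_def)
  then have "(\<Sum>j\<in>J. g s j L) \<notin> low L"
    using escaping[of s] unfolding escaping_def by blast
  ultimately have top_sum: "(\<Sum>y\<in>{y\<in>Y. snd y = L}. gen (fst y) (snd y)) \<notin> low L"
    by simp
  have rest: "(\<Sum>y\<in>{y\<in>Y. snd y \<noteq> L}. gen (fst y) (snd y)) \<in> low L"
  proof (rule low_sum)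
    fix y assume y: "y \<in> {y\<in>Y. snd y \<noteq> L}"
    obtain t' l' where tl': "y = (t', l')"
      by fastforce
    then have "l' < L"
      using y L[of t' l'] by auto
    moreover have "fst t' \<in> S" "l' \<in> A (fst t')" "s \<in> S" "L \<in> A s" "t' \<in> indices"
      using Y(2)[OF sj] Y(2)[of t' l'] y tl' by auto
    ultimately have "K (fst t') l' < L" "t' \<in> indices"
      using sparse unfolding sparse_def by blast+
    then show "gen (fst y) (snd y) \<in> low L"
      using K[of t' l'] low_mono tl' by fastforce
  qed
  have "Y = {y\<in>Y. snd y = L} \<union> {y\<in>Y. snd y \<noteq> L}"
    by auto
  then have "(\<Sum>y\<in>Y. gen (fst y) (snd y)) =
      (\<Sum>y\<in>{y\<in>Y. snd y = L}. gen (fst y) (snd y)) + (\<Sum>y\<in>{y\<in>Y. snd y \<noteq> L}. gen (fst y) (snd y))"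
    using Y(1) by (subst sum.union_disjoint[symmetric]) auto
  then have "(\<Sum>y\<in>Y. gen (fst y) (snd y)) \<notin> low L"
    using top_sum low_add_iff[OF rest] by simp
  then show ?thesis
    using low_mono L[OF tl] by blast
qed

text \<open>Here each step \<open>k\<close> brings a generator \<open>\<tau> k\<close> that is
  absent before. In a linear relation with largest step \<open>k\<close> it must be matched by an
  entry of row \<open>\<tau> k\<close>. If this row is used only at late indices, the right-hand
  side leaves the finite subgroup that contains the left-hand side.\<close>

lemma ev_separate_unbounded_support:
  fixes uh :: "nat \<Rightarrow> bit poly" and uw :: "nat \<Rightarrow> ('s \<times> nat) set"
  assumes uw: "\<And>k. finite (uw k)" "\<And>k. uw k \<subseteq> indices"
    and \<tau>: "\<And>k. \<tau> k \<in> uw k" "\<And>k k'. k' < k \<Longrightarrow> \<tau> k \<notin> uw k'"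
    and w: "finite w" "w \<subseteq> indices"
  obtains A k0 where "\<And>k. k \<ge> k0 \<Longrightarrow> ev (uh k) (uw k) A \<noteq> ev h w A"
proof -
  define T where "T = (\<Union>k. uw k) \<union> w"
  have T: "T \<subseteq> indices" "countable T"
    using uw w unfolding T_def by (auto intro: countable_finite)
  have \<tau>_inj: "k = k'" if "\<tau> k = \<tau> k'" for k k'
    using \<tau> that by (metis nat_neq_iff)
  have "countable (fst ` T)"
    using T(2) by simp
  then obtain A where A: "sparse (fst ` T) bound A" "\<And>s. s \<in> fst ` T \<Longrightarrow> A s \<in> p s"
    using sparseE[of "fst ` T" bound] by metis
  have "\<exists>N\<ge>k. uh ` {..k} \<subseteq> low N" for k
    using finite_imp_low[of "uh ` {..k}" k] by blast
  then obtain M where M: "\<And>k. k \<le> M k" "\<And>k. uh ` {..k} \<subseteq> low (M k)"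
    by metis
  \<comment> \<open>Row \<open>\<tau> k\<close> is used only from \<open>M k\<close> on. As \<tau>
    is injective, each set loses only finitely many indices.\<close>
  define B where "B t = A (fst t) - {l. \<exists>k. \<tau> k = t \<and> l < M k}" for t
  have B: "B t \<in> p (fst t)" if t: "t \<in> T" for t
    unfolding B_def
  proof (rule free_ultrafilter_nat_Diff_finite[OF free])
    show "A (fst t) \<in> p (fst t)"
      using A(2) t by blast
    show "finite {l. \<exists>k. \<tau> k = t \<and> l < M k}"
    proof (cases "\<exists>k. \<tau> k = t")
      case True
      then obtain k where "\<tau> k = t"
        by blast
      then have "{l. \<exists>k. \<tau> k = t \<and> l < M k} \<subseteq> {..<M k}"
        using \<tau>_inj by blast
      then show ?thesis
        using finite_subset by blast
    qed simp
  qed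
  obtain N where N: "h \<in> low N"
    using finite_imp_low[of "{h}" 0] by blast
  have "finite (\<tau> -` w)"
    by (rule finite_vimageI[OF w(1)]) (use \<tau>_inj in \<open>auto simp: inj_def\<close>)
  then obtain k1 where k1: "\<And>k. \<tau> k \<in> w \<Longrightarrow> k < k1"
    using finite_nat_bounded[of "\<tau> -` w"] by auto
  \<comment> \<open>From \<open>k0\<close> on, \<open>\<tau> k\<close> is not in \<open>w\<close>
    and \<open>h\<close> lies in \<open>low (M k)\<close>.\<close>
  define k0 where "k0 = max N k1"
  have "\<exists>A. \<forall>k\<in>{k0..}. ev (uh k) (uw k) A \<noteq> ev h w A"
  proof (rule ev_separate[OF B])
    fix Z Y
    assume Z: "finite Z" "Z \<subseteq> {k0..}" "Z \<noteq> {}" and Y: "finite Y" "Y \<subseteq> Sigma T B"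
      and eq: "(\<Sum>k\<in>Z. uh k + h) = (\<Sum>y\<in>Y. gen (fst y) (snd y))"
      and par: "\<And>t. (\<Sum>k\<in>Z. of_bool (t \<in> uw k) + of_bool (t \<in> w)) = (\<Sum>y\<in>Y. of_bool (t = fst y) :: bit)"
    define k where "k = Max Z"
    have k: "k \<in> Z" "\<And>k'. k' \<in> Z \<Longrightarrow> k' \<le> k"
      unfolding k_def using Z by auto
    have kk0: "k \<ge> k0"
      using k Z by auto
    then have "\<tau> k \<notin> w"
      using k1[of k] by (auto simp: k0_def)
    then have "(\<Sum>k'\<in>Z. of_bool (\<tau> k \<in> uw k') + of_bool (\<tau> k \<in> w)) = (\<Sum>k'\<in>Z. if k' = k then 1 else 0 :: bit)"
      using \<tau> k(2) by (intro sum.cong) (auto simp: le_less)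
    also have "\<dots> = 1"
      using Z(1) k(1) by simp
    finally have "(\<Sum>y\<in>Y. of_bool (\<tau> k = fst y) :: bit) \<noteq> 0"
      unfolding par by simp
    then obtain y where y: "y \<in> Y" "of_bool (\<tau> k = fst y) \<noteq> (0 :: bit)"
      by (rule sum.not_neutral_contains_not_neutral)
    then obtain l where l: "(\<tau> k, l) \<in> Y"
      by (cases y) (auto split: if_splits)
    have "(\<Sum>y\<in>Y. gen (fst y) (snd y)) \<notin> low l"
    proof (rule sparse_sum_not_low[OF A(1) gen_in_low_bound Y(1) _ l])
      show "t \<in> indices \<and> fst t \<in> fst ` T \<and> l \<in> A (fst t)" if "(t, l) \<in> Y" for t l
        using that Y(2) T(1) by (auto simp: B_def)
    qed
    moreover have "M k \<le> l"
      using l Y(2) by (auto simp: B_def not_less)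
    moreover have "(\<Sum>k\<in>Z. uh k + h) \<in> low (M k)"
    proof (intro low_sum low_add)
      fix k' assume "k' \<in> Z"
      then show "uh k' \<in> low (M k)"
        using M(2)[of k] k(2) by auto
      show "h \<in> low (M k)"
        by (rule low_mono[OF N]) (use kk0 M(1)[of k] in \<open>simp add: k0_def\<close>)
    qed
    ultimately show False
      using eq low_mono by metis
  qed (use uw w in \<open>auto simp: T_def\<close>)
  then show ?thesis
    using that by auto
qed


text \<open>The system is triangular: in a relation with largest step \<open>k\<close>, all other
  polynomials lie in \<open>low (N k)\<close>. So \<open>uh k\<close> would be there too, up to
  array entries, contrary to \<open>new\<close>.\<close>

lemma ev_separate_triangular:
  fixes uh :: "nat \<Rightarrow> bit poly" and uw :: "nat \<Rightarrow> ('s \<times> nat) set"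
  assumes A: "\<And>t. t \<in> T \<Longrightarrow> A (fst t) \<in> p (fst t)"
    and N: "strict_mono N"
    and uw: "\<And>k. k \<in> Q \<Longrightarrow> finite (uw k)" "\<And>k. k \<in> Q \<Longrightarrow> uw k \<subseteq> T"
    and w: "finite w" "w \<subseteq> T"
    and Q: "\<And>k. k \<in> Q \<Longrightarrow> b \<le> k"
    and h: "h \<in> low (N b)"
    and uh: "\<And>k. k \<in> Q \<Longrightarrow> uh k \<in> low (N (Suc k))"
    and new: "\<And>k Y. k \<in> Q \<Longrightarrow> finite Y \<Longrightarrow> Y \<subseteq> (SIGMA t:T. A (fst t)) \<Longrightarrow>
      uh k + (\<Sum>y\<in>Y. gen (fst y) (snd y)) \<notin> low (N k)"
  shows "\<exists>A. \<forall>k\<in>Q. ev (uh k) (uw k) A \<noteq> ev h w A"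
proof (rule ev_separate[OF A _ _ w])
  fix Z Y
  assume Z: "finite Z" "Z \<subseteq> Q" "Z \<noteq> {}" and Y: "finite Y" "Y \<subseteq> (SIGMA t:T. A (fst t))"
    and eq: "(\<Sum>k\<in>Z. uh k + h) = (\<Sum>y\<in>Y. gen (fst y) (snd y))"
  define k where "k = Max Z"
  have k: "k \<in> Z" "\<And>k'. k' \<in> Z \<Longrightarrow> k' \<le> k"
    unfolding k_def using Z by auto
  have kQ: "k \<in> Q"
    using k Z by blast
  have mono: "N i \<le> N j" if "i \<le> j" for i j
    using N that by (simp add: strict_mono_less_eq)
  have h': "h \<in> low (N k)"
    using low_mono[OF h] mono[OF Q[OF kQ]] by blast
  have rest: "(\<Sum>k'\<in>Z - {k}. uh k' + h) \<in> low (N k)"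
  proof (intro low_sum low_add h')
    fix k' assume k': "k' \<in> Z - {k}"
    then have "Suc k' \<le> k"
      using k(2)[of k'] by auto
    moreover have "uh k' \<in> low (N (Suc k'))"
      using k' Z(2) by (intro uh) auto
    ultimately show "uh k' \<in> low (N k)"
      using low_mono mono by blast
  qed
  have "(\<Sum>y\<in>Y. gen (fst y) (snd y)) = uh k + h + (\<Sum>k'\<in>Z - {k}. uh k' + h)"
    using Z(1) k(1) eq by (simp add: sum.remove)
  then have "uh k + (\<Sum>y\<in>Y. gen (fst y) (snd y)) = h + (\<Sum>k'\<in>Z - {k}. uh k' + h)"
    by (simp add: add.assoc)
  also have "\<dots> \<in> low (N k)"
    by (rule low_add[OF h' rest])
  finally show False
    using new[OF kQ Y] by blast
qed (use uw in auto)

text \<open>At each late stage some coordinate \<open>i \<le> q\<close> is independent of the array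
  entries involved. The stages at which a fixed coordinate has this property form a triangular
  system, so finitely many characters cover all late stages.\<close>

lemma ev_separate_bounded_support:
  fixes uh :: "nat \<Rightarrow> nat \<Rightarrow> bit poly" and uw :: "nat \<Rightarrow> nat \<Rightarrow> ('s \<times> nat) set"
  assumes N: "strict_mono N"
    and X: "\<And>i. finite (X i)" "\<And>i. X i \<subseteq> indices" "\<And>i k. uw i k \<subseteq> X i"
    and w: "\<And>i. finite (w i)" "\<And>i. w i \<subseteq> indices"
    and uh_low: "\<And>i k. i \<le> k \<Longrightarrow> uh i k \<in> low (N (Suc k))"
    and uh_new: "\<And>i k. i \<le> k \<Longrightarrow> uh i k \<notin> low (N k)"
    and uh_indep: "\<And>i j k. i < j \<Longrightarrow> j \<le> k \<Longrightarrow> uh i k + uh j k \<notin> low (N k)"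
  obtains F q k0 where "finite F"
    "\<forall>k\<ge>k0. \<exists>i\<le>q. \<exists>A\<in>F. ev (uh i k) (uw i k) A \<noteq> ev (h i) (w i) A"
proof -
  define P where "P i = fst ` (X i \<union> w i)" for i
  have fin_P: "finite (P i)" for i
    using X(1) w(1) by (simp add: P_def)
  \<comment> \<open>\<open>q\<close> has to be known before the arrays of the coordinates up to
    \<open>q\<close> are collected in \<open>S\<close>, so it depends on coordinate 0 alone:
    \<open>n\<close> bounds the number of rows of each array in \<open>P 0\<close>.\<close>
  define n where "n = (\<Sum>s\<in>P 0. m s)"
  define q where "q = (2::nat) ^ n"
  define S where "S = (\<Union>i\<le>q. P i)"
  have "countable S"
    using fin_P by (simp add: S_def countable_finite)
  \<comment> \<open>Applying \<open>N\<close> to the degree bound has this effect: after an entry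
    outside \<open>low (N k)\<close> no further index of the union lies below
    \<open>N (Suc k)\<close>.\<close>
  then obtain A where A: "sparse S (\<lambda>s l. N (bound s l)) A" "\<And>s. s \<in> S \<Longrightarrow> A s \<in> p s"
    using sparseE[of S "\<lambda>s l. N (bound s l)"] by metis
  have mono: "N i \<le> N j" if "i \<le> j" for i j
    using N that by (simp add: strict_mono_less_eq)
  have N_ge: "i \<le> N i" for i
    using N by (rule strict_mono_imp_increasing)
  have gen_low: "gen t l \<in> low (N (bound (fst t) l))" if "t \<in> indices" for t l
    using gen_in_low_bound[OF that] N_ge low_mono by blast
  define D where "D R = (SIGMA t:{t\<in>indices. fst t \<in> R}. A (fst t))" for R
  define new where "new i R k \<longleftrightarrow> (\<forall>Y. finite Y \<longrightarrow> Y \<subseteq> D R \<longrightarrow>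
      uh i k + (\<Sum>y\<in>Y. gen (fst y) (snd y)) \<notin> low (N k))" for i R k
  \<comment> \<open>From stage \<open>N0\<close> on, \<open>q \<le> k\<close> holds and
    \<open>low (N k)\<close> contains \<open>h i\<close> for all \<open>i \<le> q\<close>.\<close>
  obtain N0 where N0: "h ` {..q} \<subseteq> low N0" "q \<le> N0"
    using finite_imp_low[of "h ` {..q}" q] by auto
  have P_sub: "P i \<subseteq> S" if "i \<le> q" for i
    using that by (auto simp: S_def)
  have separate: "\<exists>A. \<forall>k\<in>{k. N0 \<le> k \<and> new i R k}. ev (uh i k) (uw i k) A \<noteq> ev (h i) (w i) A"
    if i: "i \<le> q" and R: "P i \<subseteq> R" "R \<subseteq> S" for i R
  proof (rule ev_separate_triangular[where T = "{t\<in>indices. fst t \<in> R}" and A = A and N = N and b = N0])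
    show "A (fst t) \<in> p (fst t)" if "t \<in> {t\<in>indices. fst t \<in> R}" for t
      using that A(2) R(2) by blast
    show "finite (uw i k)" for k
      by (rule finite_subset[OF X(3) X(1)])
    show "uw i k \<subseteq> {t\<in>indices. fst t \<in> R}" for k
      using X(2)[of i] X(3)[of i k] R(1) by (auto simp: P_def)
    show "w i \<subseteq> {t\<in>indices. fst t \<in> R}"
      using w(2)[of i] R(1) by (auto simp: P_def)
    show "h i \<in> low (N N0)"
      by (rule low_mono[OF _ N_ge]) (use N0(1) i in auto)
    show "uh i k \<in> low (N (Suc k))" if "k \<in> {k. N0 \<le> k \<and> new i R k}" for k
      using that i N0(2) by (intro uh_low) auto
    show "uh i k + (\<Sum>y\<in>Y. gen (fst y) (snd y)) \<notin> low (N k)"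
      if "k \<in> {k. N0 \<le> k \<and> new i R k}" "finite Y" "Y \<subseteq> (SIGMA t:{t\<in>indices. fst t \<in> R}. A (fst t))" for k Y
      using that unfolding new_def D_def by blast
  qed (use N w in auto)
  have "\<exists>A. \<forall>k\<in>{k. N0 \<le> k \<and> new 0 (P 0) k}. ev (uh 0 k) (uw 0 k) A \<noteq> ev (h 0) (w 0) A"
    using separate[of 0 "P 0"] P_sub[of 0] by auto
  then obtain A0 where A0: "\<And>k. N0 \<le> k \<Longrightarrow> new 0 (P 0) k \<Longrightarrow> ev (uh 0 k) (uw 0 k) A0 \<noteq> ev (h 0) (w 0) A0"
    by blast
  have "\<exists>A. \<forall>k\<in>{k. N0 \<le> k \<and> new i S k}. ev (uh i k) (uw i k) A \<noteq> ev (h i) (w i) A" if "i \<le> q" for i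
    using separate[OF that P_sub[OF that]] by auto
  then have "\<forall>i\<in>{..q}. \<exists>A. \<forall>k\<in>{k. N0 \<le> k \<and> new i S k}. ev (uh i k) (uw i k) A \<noteq> ev (h i) (w i) A"
    by blast
  from bchoice[OF this] obtain A1
    where A1: "\<And>i k. i \<le> q \<Longrightarrow> N0 \<le> k \<Longrightarrow> new i S k \<Longrightarrow> ev (uh i k) (uw i k) (A1 i) \<noteq> ev (h i) (w i) (A1 i)"
    by auto
  text \<open>Modulo \<open>low (N k)\<close>, only one index \<open>l\<close> of only one array contributes to the sums
    lying in \<open>low (N (Suc k))\<close>. If coordinate 0 is not new, this array belongs to \<open>P 0\<close>, so it has
    at most \<open>n\<close> rows and two of the \<open>2 ^ n + 1\<close> coordinates agree modulo \<open>low (N k)\<close>.\<close>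
  have one_new: "new 0 (P 0) k \<or> (\<exists>i\<le>q. new i S k)" if k: "q \<le> k" for k
  proof (rule ccontr)
    assume contra: "\<not> ?thesis"
    define amb where "amb y \<longleftrightarrow> gen (fst y) (snd y) \<notin> low (N k)" for y
    have DS: "t \<in> indices \<and> fst t \<in> S \<and> l \<in> A (fst t)" if "Y \<subseteq> D S" "(t, l) \<in> Y" for Y t l
      using that by (auto simp: D_def)
    \<comment> \<open>The sum lies in \<open>low (N (Suc k))\<close> because \<open>uh i k\<close>
      does; by \<open>sparse_sum_not_low\<close> an index from \<open>N (Suc k)\<close> on is
      impossible.\<close>
    have early: "snd y < N (Suc k)"
      if Y: "finite Y" "Y \<subseteq> D S" and y: "y \<in> Y" and i: "i \<le> q"
        and eq: "uh i k + (\<Sum>y\<in>Y. gen (fst y) (snd y)) \<in> low (N k)" for Y y i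
    proof (rule ccontr)
      assume *: "\<not> snd y < N (Suc k)"
      have "uh i k + (\<Sum>y\<in>Y. gen (fst y) (snd y)) \<in> low (N (Suc k))"
        using low_mono[OF eq] mono[of k "Suc k"] by simp
      then have "(\<Sum>y\<in>Y. gen (fst y) (snd y)) \<in> low (N (Suc k))"
        using uh_low[of i k] i k low_add_iff by (metis add.commute le_trans)
      then have "(\<Sum>y\<in>Y. gen (fst y) (snd y)) \<in> low (snd y)"
        using * low_mono by simp
      moreover have "(fst y, snd y) \<in> Y"
        using y by simp
      ultimately show False
        using sparse_sum_not_low[OF A(1) gen_low Y(1) DS[OF Y(2)]] by blast
    qed
    have unique: "fst (fst y) = fst (fst z) \<and> snd y = snd z"
      if yz: "y \<in> D S" "z \<in> D S" "amb y" "amb z" "snd y < N (Suc k)" "snd z < N (Suc k)" for y z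
    proof -
      have big: "N (Suc k) \<le> N (bound (fst (fst y)) (snd y))" if "y \<in> D S" "amb y" for y
      proof (rule mono, rule ccontr)
        assume "\<not> Suc k \<le> bound (fst (fst y)) (snd y)"
        moreover have "gen (fst y) (snd y) \<in> low (bound (fst (fst y)) (snd y))"
          using that(1) by (intro gen_in_low_bound) (auto simp: D_def)
        ultimately have "gen (fst y) (snd y) \<in> low (N k)"
          using low_mono N_ge[of k] by (metis le_trans not_less_eq_eq)
        with that(2) show False
          by (simp add: amb_def)
      qed
      have mem: "fst (fst y) \<in> S \<and> snd y \<in> A (fst (fst y))" if "y \<in> D S" for y
        using that by (auto simp: D_def)
      have "\<not> snd y < snd z" if "y \<in> D S" "z \<in> D S" "amb y" "snd z < N (Suc k)" for y z
      proof
        assume "snd y < snd z"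
        then have "N (bound (fst (fst y)) (snd y)) < snd z"
          using A(1) mem[OF that(1)] mem[OF that(2)] unfolding sparse_def by blast
        with big[OF that(1,3)] that(4) show False
          by simp
      qed
      then have "snd y = snd z"
        using yz by (metis nat_neq_iff)
      moreover have "fst (fst y) = fst (fst z)"
      proof (rule ccontr)
        assume "fst (fst y) \<noteq> fst (fst z)"
        then have "A (fst (fst y)) \<inter> A (fst (fst z)) = {}"
          using A(1) mem[OF yz(1)] mem[OF yz(2)] unfolding sparse_def by blast
        then show False
          using mem[OF yz(1)] mem[OF yz(2)] \<open>snd y = snd z\<close> by auto
      qed
      ultimately show ?thesis
        by simp
    qed
    have D_mono: "D (P 0) \<subseteq> D S"
      using P_sub[of 0] by (auto simp: D_def)
    from contra obtain Y0 where Y0: "finite Y0" "Y0 \<subseteq> D (P 0)"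
      "uh 0 k + (\<Sum>y\<in>Y0. gen (fst y) (snd y)) \<in> low (N k)"
      unfolding new_def by blast
    have "\<exists>y\<in>Y0. amb y"
    proof (rule ccontr)
      assume "\<not> (\<exists>y\<in>Y0. amb y)"
      then have "(\<Sum>y\<in>Y0. gen (fst y) (snd y)) \<in> low (N k)"
        by (intro low_sum) (auto simp: amb_def)
      then show False
        using Y0(3) low_add_iff uh_new[of 0 k] by blast
    qed
    then obtain y0 where y0: "y0 \<in> Y0" "amb y0"
      by blast
    define s l where "s = fst (fst y0)" and "l = snd y0"
    have y0_early: "snd y0 < N (Suc k)"
      using early[of Y0 y0 0] Y0 y0(1) D_mono by blast
    have s: "s \<in> P 0"
      using y0(1) Y0(2) by (auto simp: D_def s_def)
    have "\<exists>Y. finite Y \<and> Y \<subseteq> D S \<and> uh i k + (\<Sum>y\<in>Y. gen (fst y) (snd y)) \<in> low (N k)" if "i \<le> q" for i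
      using contra that unfolding new_def by blast
    then have "\<forall>i\<in>{..q}. \<exists>Y. finite Y \<and> Y \<subseteq> D S \<and> uh i k + (\<Sum>y\<in>Y. gen (fst y) (snd y)) \<in> low (N k)"
      by blast
    from bchoice[OF this] obtain Y
      where Y: "\<And>i. i \<le> q \<Longrightarrow> finite (Y i)" "\<And>i. i \<le> q \<Longrightarrow> Y i \<subseteq> D S"
        "\<And>i. i \<le> q \<Longrightarrow> uh i k + (\<Sum>y\<in>Y i. gen (fst y) (snd y)) \<in> low (N k)"
      by auto
    \<comment> \<open>By \<open>unique\<close>, these rows of the array \<open>s\<close> at the one
      index \<open>l\<close> account for the whole sum modulo \<open>low (N k)\<close>.\<close>
    define J where "J i = {j. ((s, j), l) \<in> Y i}" for i
    have uh_J: "uh i k + (\<Sum>j\<in>J i. g s j l) \<in> low (N k)" if i: "i \<le> q" for i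
    proof -
      let ?E = "(\<lambda>j. ((s, j), l)) ` J i"
      have rest: "(\<Sum>y\<in>Y i - ?E. gen (fst y) (snd y)) \<in> low (N k)"
      proof (rule low_sum, rule ccontr)
        fix y assume y: "y \<in> Y i - ?E" and "gen (fst y) (snd y) \<notin> low (N k)"
        then have "amb y" "y \<in> D S" "y0 \<in> D S"
          using Y(2)[OF i] y0(1) Y0(2) D_mono by (auto simp: amb_def)
        then have "fst (fst y) = s \<and> snd y = l"
          using unique[of y y0] y0(2) y0_early early[OF Y(1,2)[OF i] _ i Y(3)[OF i], of y] y
          by (auto simp: s_def l_def)
        then have "y = ((s, snd (fst y)), l)"
          by (metis prod.collapse)
        then have "y \<in> ?E"
          using y unfolding J_def by (metis DiffD1 image_eqI mem_Collect_eq)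
        then show False
          using y by blast
      qed
      have "?E \<subseteq> Y i"
        by (auto simp: J_def)
      then have "(\<Sum>y\<in>Y i. gen (fst y) (snd y)) =
          (\<Sum>y\<in>Y i - ?E. gen (fst y) (snd y)) + (\<Sum>y\<in>?E. gen (fst y) (snd y))"
        using Y(1)[OF i] by (rule sum.subset_diff)
      moreover have "(\<Sum>y\<in>?E. gen (fst y) (snd y)) = (\<Sum>j\<in>J i. g s j l)"
        by (simp add: sum.reindex inj_on_def gen_def)
      ultimately have "uh i k + (\<Sum>y\<in>Y i. gen (fst y) (snd y)) =
          (uh i k + (\<Sum>j\<in>J i. g s j l)) + (\<Sum>y\<in>Y i - ?E. gen (fst y) (snd y))"
        by (simp only: ac_simps)
      then show ?thesis
        using Y(3)[OF i] by (simp only: low_add_iff[OF rest])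
    qed
    have "J ` {..q} \<subseteq> Pow {..<m s}"
      using Y(2) by (fastforce simp: J_def D_def indices_def)
    then have "card (J ` {..q}) \<le> 2 ^ m s"
      using card_mono[of "Pow {..<m s}" "J ` {..q}"] by (simp add: card_Pow)
    also have "\<dots> \<le> q"
      using member_le_sum[of s "P 0" m] s fin_P by (simp add: q_def n_def)
    finally have "card (J ` {..q}) < card {..q}"
      by simp
    then have "\<not> inj_on J {..q}"
      by (rule pigeonhole)
    then obtain i j where ij: "i < j" "j \<le> q" "J i = J j"
      unfolding inj_on_def by (metis atMost_iff nat_neq_iff)
    have "uh i k + uh j k = (uh i k + (\<Sum>a\<in>J i. g s a l)) + (uh j k + (\<Sum>a\<in>J j. g s a l))"
      by (simp add: ij(3) ac_simps)
    also have "\<dots> \<in> low (N k)"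
      using ij by (intro low_add uh_J) auto
    finally show False
      using uh_indep[OF ij(1), of k] ij(2) k by simp
  qed
  show ?thesis
  proof (rule that)
    show "finite (insert A0 (A1 ` {..q}))"
      by simp
    show "\<forall>k\<ge>N0. \<exists>i\<le>q. \<exists>A\<in>insert A0 (A1 ` {..q}). ev (uh i k) (uw i k) A \<noteq> ev (h i) (w i) A"
      using one_new A0 A1 N0(2) by (meson atMost_iff image_eqI insertCI le0 le_trans)
  qed
qed


section \<open>Failure of countable pracompactness for the countable power\<close>

section \<open>The countable power\<close>

lemma finite_ev_separate:
  assumes "finite R" "finite Y" "\<And>r. r \<in> R \<Longrightarrow> ev r {} \<notin> Y"
  obtains F where "finite F" "\<And>r y. r \<in> R \<Longrightarrow> y \<in> Y \<Longrightarrow> \<exists>A\<in>F. ev r {} A \<noteq> y A"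
proof -
  have "\<exists>A. ev r {} A \<noteq> y A" if "r \<in> R" "y \<in> Y" for r y
    using assms(3)[OF that(1)] that(2) by (metis ext)
  then obtain A where A: "\<And>r y. r \<in> R \<Longrightarrow> y \<in> Y \<Longrightarrow> ev r {} (A r y) \<noteq> y (A r y)"
    by metis
  have "finite (case_prod A ` (R \<times> Y))"
    using assms by simp
  moreover have "\<exists>A'\<in>case_prod A ` (R \<times> Y). ev r {} A' \<noteq> y A'" if "r \<in> R" "y \<in> Y" for r y
    using A[OF that] that by (intro bexI[of _ "A r y"]) auto
  ultimately show ?thesis
    by (rule that)
qed

lemma not_countably_pracompact_omega_power:
  "\<not> countably_pracompact (product_topology (\<lambda>_. limit_topology) (UNIV :: nat set))"
proof
  assume "countably_pracompact (product_topology (\<lambda>_. limit_topology) (UNIV :: nat set))" (is "countably_pracompact ?P")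
  then obtain D where D: "D \<subseteq> topspace ?P" "?P closure_of D = topspace ?P"
    and acc: "\<And>S. S \<subseteq> D \<Longrightarrow> infinite S \<Longrightarrow> ?P derived_set_of S \<noteq> {}"
    unfolding countably_pracompact_def by metis
  have top: "topspace ?P = UNIV \<rightarrow>\<^sub>E elements"
    by (simp add: limit_topology_def)
  have D_elements: "d i \<in> elements" if "d \<in> D" for d i
    using that D(1) unfolding top by auto
  have dense: "\<exists>d\<in>D. \<forall>i\<in>J. \<forall>A\<in>F. val (d i) A = val (x i) A"
    if "\<And>i. x i \<in> elements" "finite J" "finite F" for x J F
  proof -
    have "\<forall>x\<in>UNIV \<rightarrow>\<^sub>E elements. \<forall>J F. finite J \<longrightarrow> J \<subseteq> UNIV \<longrightarrow> finite F \<longrightarrow>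
      (\<exists>d\<in>D. d \<in> UNIV \<rightarrow>\<^sub>E elements \<and> (\<forall>i\<in>J. \<forall>a\<in>F. val (d i) a = val (x i) a))"
      using D(2)[unfolded top] unfolding limit_topology_def by (rule iffD1[OF dense_product_pointwise_topology])
    moreover have "x \<in> UNIV \<rightarrow>\<^sub>E elements"
      using that(1) by auto
    ultimately show ?thesis
      using that(2,3) by (meson subset_UNIV)
  qed
  \<comment> \<open>Every neighbourhood of an accumulation point contains infinitely many terms, so
    agreement recurs beyond any \<open>k0\<close>.\<close>
  have acc_seq: "\<exists>y. (\<forall>i. y i \<in> elements) \<and> (\<forall>J F k0. finite J \<longrightarrow> finite F \<longrightarrow>
      (\<exists>k\<ge>k0. \<forall>i\<in>J. \<forall>A\<in>F. val (d k i) A = val (y i) A))"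
    if d: "\<And>k. d k \<in> D" "inj d" for d :: "nat \<Rightarrow> nat \<Rightarrow> 'b"
  proof -
    have "?P derived_set_of range d \<noteq> {}"
      using d(1) range_inj_infinite[OF d(2)] by (intro acc) auto
    then obtain y where "y \<in> ?P derived_set_of range d"
      by blast
    then have y: "y \<in> UNIV \<rightarrow>\<^sub>E elements"
      and inf: "\<And>J F. finite J \<Longrightarrow> finite F \<Longrightarrow> infinite {e\<in>range d. e \<in> UNIV \<rightarrow>\<^sub>E elements \<and>
        (\<forall>i\<in>J. \<forall>A\<in>F. val (e i) A = val (y i) A)}"
      unfolding limit_topology_def derived_set_of_product_pointwise_topology[OF inj_on_val] by blast+
    have "\<exists>k\<ge>k0. \<forall>i\<in>J. \<forall>A\<in>F. val (d k i) A = val (y i) A" if "finite J" "finite F" for J F k0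
    proof (rule ccontr)
      assume contra: "\<not> ?thesis"
      have "{e\<in>range d. e \<in> UNIV \<rightarrow>\<^sub>E elements \<and> (\<forall>i\<in>J. \<forall>A\<in>F. val (e i) A = val (y i) A)} \<subseteq> d ` {..<k0}"
      proof
        fix e assume "e \<in> {e\<in>range d. e \<in> UNIV \<rightarrow>\<^sub>E elements \<and> (\<forall>i\<in>J. \<forall>A\<in>F. val (e i) A = val (y i) A)}"
        then obtain k where "e = d k" "\<forall>i\<in>J. \<forall>A\<in>F. val (d k i) A = val (y i) A"
          by blast
        then show "e \<in> d ` {..<k0}"
          using contra by (meson imageI lessThan_iff not_le)
      qed
      then show False
        using inf[OF that] finite_subset by blast
    qed
    then show ?thesis
      using y by (intro exI[of _ y]) auto
  qed
  have "\<forall>x\<in>elements. \<exists>hw. finite (snd hw) \<and> snd hw \<subseteq> indices \<and> val x = ev (fst hw) (snd hw)"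
  proof
    fix x assume "x \<in> elements"
    then obtain h w where "finite w" "w \<subseteq> indices" "x = code (ev h w)"
      by (rule elementsE)
    then show "\<exists>hw. finite (snd hw) \<and> snd hw \<subseteq> indices \<and> val x = ev (fst hw) (snd hw)"
      by (intro exI[of _ "(h, w)"]) simp
  qed
  from bchoice[OF this] obtain hw where
    hw: "\<And>x. x \<in> elements \<Longrightarrow> finite (snd (hw x)) \<and> snd (hw x) \<subseteq> indices \<and> val x = ev (fst (hw x)) (snd (hw x))"
    by blast
  \<comment> \<open>These fix one representation of each element, chosen once and for all;
    \<open>X i\<close> collects the generators that it uses in coordinate \<open>i\<close> of
    \<open>D\<close>.\<close>
  define hh ww where "hh x = fst (hw x)" and "ww x = snd (hw x)" for x
  have rep: "finite (ww x)" "ww x \<subseteq> indices" "val x = ev (hh x) (ww x)" if "x \<in> elements" for x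
    using hw[OF that] by (simp_all add: hh_def ww_def)
  define X where "X i = (\<Union>d\<in>D. ww (d i))" for i
  show False
  proof (cases "\<exists>i. infinite (X i)")
    case True
    then obtain i where i: "infinite (X i)"
      by blast
    have "\<exists>d. d \<in> D \<and> \<not> ww (d i) \<subseteq> W" if "finite W" for W
      using i finite_subset[OF _ that, of "X i"] unfolding X_def by blast
    then obtain pick where pick: "\<And>W. finite W \<Longrightarrow> pick W \<in> D" "\<And>W. finite W \<Longrightarrow> \<not> ww (pick W i) \<subseteq> W"
      by metis
    \<comment> \<open>\<open>W k\<close> holds the generators used before step \<open>k\<close> in
      coordinate \<open>i\<close>. It is finite and \<open>X i\<close> is not, so \<open>D\<close>
      can supply a new one.\<close>
    define W where "W = rec_nat {} (\<lambda>_ W. W \<union> ww (pick W i))"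
    have W: "W 0 = {}" "W (Suc k) = W k \<union> ww (pick (W k) i)" for k
      by (simp_all add: W_def)
    have fin_W: "finite (W k)" for k
      by (induction k) (simp_all add: W pick(1) D_elements rep(1))
    define d where "d k = pick (W k)" for k
    have d: "d k \<in> D" "\<not> ww (d k i) \<subseteq> W k" for k
      using pick[OF fin_W] by (simp_all add: d_def)
    have "\<exists>t. t \<in> ww (d k i) \<and> t \<notin> W k" for k
      using d(2)[of k] by blast
    then obtain \<tau> where \<tau>: "\<And>k. \<tau> k \<in> ww (d k i)" "\<And>k. \<tau> k \<notin> W k"
      by metis
    have W_mono: "W j \<subseteq> W k" if "j \<le> k" for j k
      using lift_Suc_mono_le[of W, OF _ that] W(2) by blast
    have \<tau>_new: "\<tau> k \<notin> ww (d j i)" if "j < k" for j k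
      using \<tau>(2)[of k] W_mono[of "Suc j" k] that W(2)[of j] by (auto simp: d_def)
    have "inj d"
      by (rule linorder_injI) (metis \<tau>(1) \<tau>_new)
    then obtain y where y: "\<And>i. y i \<in> elements" and agree: "\<And>J F k0. finite J \<Longrightarrow> finite F \<Longrightarrow>
        \<exists>k\<ge>k0. \<forall>i\<in>J. \<forall>A\<in>F. val (d k i) A = val (y i) A"
      using acc_seq[of d] d(1) by blast
    obtain A k0 where A: "\<And>k. k \<ge> k0 \<Longrightarrow> ev (hh (d k i)) (ww (d k i)) A \<noteq> ev (hh (y i)) (ww (y i)) A"
      by (rule ev_separate_unbounded_support[of "\<lambda>k. ww (d k i)" \<tau> "ww (y i)" "\<lambda>k. hh (d k i)" "hh (y i)"])
        (use \<tau>(1) \<tau>_new rep(1,2)[OF D_elements[OF d(1)]] rep(1,2)[OF y] in auto)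
    obtain k where "k \<ge> k0" "val (d k i) A = val (y i) A"
      using agree[of "{i}" "{A}" k0] by auto
    then show False
      using A[of k] rep(3)[OF D_elements[OF d(1)]] rep(3)[OF y] by metis
  next
    case False
    then have fin_X: "finite (X i)" for i
      by blast
    have pick: "\<exists>d\<in>D. (\<forall>i\<le>k. hh (d i) \<notin> low N) \<and> (\<forall>i j. i < j \<longrightarrow> j \<le> k \<longrightarrow> hh (d i) + hh (d j) \<notin> low N)" for N k
    proof -
      \<comment> \<open>These functionals have a polynomial part in \<open>low N\<close> and use
        only the finitely many generators available up to coordinate \<open>k\<close>. Finitely many
        tests keep the elements of \<open>R\<close> away from them, and density passes this on to an
        element of \<open>D\<close>.\<close>
      define Y where "Y = (\<lambda>(h, w). ev h w) ` (low N \<times> Pow (\<Union>i\<le>k. X i))"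
      have "finite Y"
        unfolding Y_def using finite_low fin_X by auto
      have Y_I: "ev h w \<in> Y" if "h \<in> low N" "w \<subseteq> (\<Union>i\<le>k. X i)" for h w
        unfolding Y_def using that by force
      have "finite ((\<lambda>h. ev h {}) -` Y)"
        by (rule finite_vimageI[OF \<open>finite Y\<close>]) (simp add: inj_def ev_inject)
      then obtain M where M: "(\<lambda>h. ev h {}) -` Y \<subseteq> low M"
        using finite_imp_low by metis
      \<comment> \<open>Every polynomial whose functional is in \<open>Y\<close> lies in
        \<open>low M\<close>; monomials from degree \<open>M\<close> on, and sums of two of them, do
        not.\<close>
      define e :: "nat \<Rightarrow> bit poly" where "e i = monom 1 (M + i)" for i
      have e1: "e i \<notin> low M" for i
        by (simp add: e_def monom_in_low_iff)
      have e2: "e i + e j \<notin> low M" if "i < j" for i j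
      proof -
        have "coeff (e i + e j) (M + i) = 1"
          using that by (simp add: e_def)
        then show ?thesis
          unfolding low_def mem_Collect_eq not_all by (intro exI[of _ "M + i"]) simp
      qed
      define R where "R = e ` {..k} \<union> (\<lambda>(i, j). e i + e j) ` {(i, j). i < j \<and> j \<le> k}"
      have "finite {(i, j). i < j \<and> j \<le> k}"
        by (rule finite_subset[of _ "{..k} \<times> {..k}"]) auto
      then have "finite R"
        by (simp add: R_def)
      have "r \<notin> low M" if "r \<in> R" for r
        using that e1 e2 by (auto simp: R_def)
      then have "ev r {} \<notin> Y" if "r \<in> R" for r
        using M that by blast
      then obtain F where F: "finite F" "\<And>r y. r \<in> R \<Longrightarrow> y \<in> Y \<Longrightarrow> \<exists>A\<in>F. ev r {} A \<noteq> y A"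
        using finite_ev_separate[OF \<open>finite R\<close> \<open>finite Y\<close>] by metis
      obtain d where d: "d \<in> D" and agree: "\<And>i A. i \<le> k \<Longrightarrow> A \<in> F \<Longrightarrow> val (d i) A = ev (e i) {} A"
        using dense[of "\<lambda>i. code (ev (e i) {})" "{..k}" F] F(1) code_ev_in_elements by auto
      have val_d: "val (d i) = ev (hh (d i)) (ww (d i))" "finite (ww (d i))" for i
        using rep[OF D_elements[OF d]] by blast+
      have ww_d: "ww (d i) \<subseteq> (\<Union>i\<le>k. X i)" if "i \<le> k" for i
        using that d by (auto simp: X_def)
      have "hh (d i) \<notin> low N" if i: "i \<le> k" for i
      proof
        assume "hh (d i) \<in> low N"
        then have "val (d i) \<in> Y"
          unfolding val_d(1) using ww_d[OF i] by (rule Y_I)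
        moreover have "e i \<in> R"
          using i by (simp add: R_def)
        ultimately obtain A where "A \<in> F" "ev (e i) {} A \<noteq> val (d i) A"
          using F(2) by blast
        then show False
          using agree[OF i] by simp
      qed
      moreover have "hh (d i) + hh (d j) \<notin> low N" if ij: "i < j" "j \<le> k" for i j
      proof
        assume "hh (d i) + hh (d j) \<in> low N"
        moreover have "sym_diff (ww (d i)) (ww (d j)) \<subseteq> (\<Union>i\<le>k. X i)"
          using ww_d[of i] ww_d[of j] ij by auto
        ultimately have "val (d i) + val (d j) \<in> Y"
          unfolding val_d(1) ev_add[OF val_d(2) val_d(2)] by (rule Y_I)
        moreover have "e i + e j \<in> R"
          using ij unfolding R_def by (intro UnI2 image_eqI[of _ _ "(i, j)"]) auto
        ultimately obtain A where A: "A \<in> F" "ev (e i + e j) {} A \<noteq> (val (d i) + val (d j)) A"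
          using F(2) by blast
        have "(val (d i) + val (d j)) A = ev (e i) {} A + ev (e j) {} A"
          using agree[of i A] agree[of j A] A(1) ij by simp
        also have "\<dots> = ev (e i + e j) {} A"
          by (simp add: ev_def pairing_add)
        finally show False
          using A(2) by simp
      qed
      ultimately show ?thesis
        using d by blast
    qed
    define good where "good k d N N' \<longleftrightarrow> d \<in> D \<and> N < N' \<and> (\<forall>i\<le>k. hh (d i) \<notin> low N \<and> hh (d i) \<in> low N') \<and>
      (\<forall>i j. i < j \<longrightarrow> j \<le> k \<longrightarrow> hh (d i) + hh (d j) \<notin> low N)" for k d N N'
    have good_ex: "\<exists>d N'. good k d N N'" for k N
    proof -
      obtain d where d: "d \<in> D" "\<forall>i\<le>k. hh (d i) \<notin> low N" "\<forall>i j. i < j \<longrightarrow> j \<le> k \<longrightarrow> hh (d i) + hh (d j) \<notin> low N"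
        using pick by blast
      obtain N' where "(\<lambda>i. hh (d i)) ` {..k} \<subseteq> low N'" "Suc N \<le> N'"
        using finite_imp_low[of "(\<lambda>i. hh (d i)) ` {..k}" "Suc N"] by auto
      with d have "good k d N N'"
        by (auto simp: good_def)
      then show ?thesis
        by blast
    qed
    \<comment> \<open>Stage \<open>k\<close> is a triple of the chosen element and two degree
      bounds, and its upper bound becomes the lower bound of the next stage.\<close>
    have "\<exists>f. \<forall>k. (case f k of (d, N, N') \<Rightarrow> good k d N N') \<and> snd (snd (f k)) = fst (snd (f (Suc k)))"
    proof (rule dependent_nat_choice)
      show "\<exists>x. case x of (d, N, N') \<Rightarrow> good 0 d N N'"
        using good_ex[of 0 0] by auto
      show "\<exists>y. (case y of (d, N, N') \<Rightarrow> good (Suc k) d N N') \<and> snd (snd x) = fst (snd y)" for x k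
        using good_ex[of "Suc k" "snd (snd x)"] by force
    qed
    then obtain f where f: "\<forall>k. (case f k of (d, N, N') \<Rightarrow> good k d N N') \<and> snd (snd (f k)) = fst (snd (f (Suc k)))"
      by (elim exE)
    define d N where "d k = fst (f k)" and "N k = fst (snd (f k))" for k
    have "good k (d k) (N k) (N (Suc k))" for k
      using f[rule_format, of k] unfolding d_def N_def case_prod_unfold by (elim conjE) simp
    then have d: "\<And>k. d k \<in> D" and N: "\<And>k. N k < N (Suc k)"
      and low_d: "\<And>i k. i \<le> k \<Longrightarrow> hh (d k i) \<in> low (N (Suc k))"
      and new_d: "\<And>i k. i \<le> k \<Longrightarrow> hh (d k i) \<notin> low (N k)"
      and indep_d: "\<And>i j k. i < j \<Longrightarrow> j \<le> k \<Longrightarrow> hh (d k i) + hh (d k j) \<notin> low (N k)"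
      unfolding good_def by blast+
    have N_mono: "strict_mono N"
      using N by (simp add: strict_mono_Suc_iff)
    have "d j \<noteq> d k" if "j < k" for j k
    proof
      assume "d j = d k"
      then have "hh (d k 0) \<in> low (N (Suc j))"
        using low_d[of 0 j] by simp
      moreover have "N (Suc j) \<le> N k"
        using that N_mono by (simp add: strict_mono_less_eq)
      ultimately show False
        using new_d[of 0 k] low_mono by blast
    qed
    then have "inj d"
      by (rule linorder_injI)
    then obtain y where y: "\<And>i. y i \<in> elements" and agree: "\<And>J F k0. finite J \<Longrightarrow> finite F \<Longrightarrow>
        \<exists>k\<ge>k0. \<forall>i\<in>J. \<forall>A\<in>F. val (d k i) A = val (y i) A"
      using acc_seq[of d] d by blast
    have X_sub: "X i \<subseteq> indices" for i
      unfolding X_def using rep(2) D_elements by blast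
    have ww_X: "ww (d k i) \<subseteq> X i" for i k
      unfolding X_def using d by blast
    obtain F q k0 where F: "finite F"
      "\<forall>k\<ge>k0. \<exists>i\<le>q. \<exists>A\<in>F. ev (hh (d k i)) (ww (d k i)) A \<noteq> ev (hh (y i)) (ww (y i)) A"
      by (rule ev_separate_bounded_support[where uh = "\<lambda>i k. hh (d k i)" and uw = "\<lambda>i k. ww (d k i)"
            and h = "\<lambda>i. hh (y i)" and w = "\<lambda>i. ww (y i)",
            OF N_mono fin_X X_sub ww_X rep(1)[OF y] rep(2)[OF y] low_d new_d indep_d])
    obtain k where k: "k \<ge> k0" "\<forall>i\<in>{..q}. \<forall>A\<in>F. val (d k i) A = val (y i) A"
      using agree[of "{..q}" F k0] F(1) by auto
    obtain i A where "i \<le> q" "A \<in> F" "ev (hh (d k i)) (ww (d k i)) A \<noteq> ev (hh (y i)) (ww (y i)) A"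
      using F(2) k(1) by blast
    then show False
      using k(2) rep(3)[OF D_elements[OF d]] rep(3)[OF y] by (metis atMost_iff)
  qed
qed

end

section \<open>Counting the arrays and choosing the carrier type\<close>

section \<open>Instantiation\<close>

text \<open>There are at most continuum many arrays, so each can receive an ultrafilter of its own.
  In the code, the tag 0 marks the number of rows and the tag \<open>Suc j\<close> the coefficients
  of row \<open>j\<close>.\<close>

lemma inj_encode_arrays:
  obtains enc :: "nat \<times> (nat \<Rightarrow> nat \<Rightarrow> bit poly) \<Rightarrow> nat set" where "inj enc"
proof
  let ?enc = "\<lambda>(n :: nat, f :: nat \<Rightarrow> nat \<Rightarrow> bit poly).
    insert (prod_encode (0, n)) {prod_encode (Suc j, prod_encode (l, i)) | j l i. coeff (f j l) i = 1}"
  show "inj ?enc"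
  proof (rule injI, clarify)
    fix n n' and f f' :: "nat \<Rightarrow> nat \<Rightarrow> bit poly"
    assume eq: "insert (prod_encode (0, n)) {prod_encode (Suc j, prod_encode (l, i)) | j l i. coeff (f j l) i = 1} =
      insert (prod_encode (0, n')) {prod_encode (Suc j, prod_encode (l, i)) | j l i. coeff (f' j l) i = 1}" (is "?E = ?E'")
    have "prod_encode (0, n) \<in> ?E'"
      using eq by blast
    then have "n = n'"
      by auto
    moreover have "coeff (f j l) i = coeff (f' j l) i" for j l i
    proof -
      have "prod_encode (Suc j, prod_encode (l, i)) \<in> ?E \<longleftrightarrow> prod_encode (Suc j, prod_encode (l, i)) \<in> ?E'"
        using eq by simp
      then have "coeff (f j l) i = 1 \<longleftrightarrow> coeff (f' j l) i = 1"
        by simp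
      then show ?thesis
        by (metis bit_not_one_iff)
    qed
    then have "f = f'"
      by (intro ext poly_eqI)
    ultimately show "n = n' \<and> f = f'"
      by blast
  qed
qed

text \<open>A functional is a set of characters and a character is a set of naturals, hence a real
  number; its singleton is a set of reals.\<close>

lemma inj_encode_functionals:
  obtains code :: "((nat \<Rightarrow> bit) \<Rightarrow> bit) \<Rightarrow> real set set" where "inj code"
proof -
  obtain e :: "nat set \<Rightarrow> real" where e: "inj e"
    using nat_sets_eqpoll_reals unfolding eqpoll_def bij_betw_def by blast
  let ?code = "\<lambda>\<Phi> :: (nat \<Rightarrow> bit) \<Rightarrow> bit. (\<lambda>A. {e {i. A i = 1}}) ` {A. \<Phi> A = 1}"
  have "inj ?code"
  proof (rule injI, rule ext)
    fix \<Phi> \<Psi> A assume eq: "?code \<Phi> = ?code \<Psi>"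
    have inj: "inj (\<lambda>A :: nat \<Rightarrow> bit. {e {i. A i = 1}})"
    proof (rule injI, rule ext)
      fix A B :: "nat \<Rightarrow> bit" and i
      assume "{e {i. A i = 1}} = {e {i. B i = 1}}"
      then have "{i. A i = 1} = {i. B i = 1}"
        using e by (simp add: inj_eq)
      then have "A i = 1 \<longleftrightarrow> B i = 1"
        by blast
      then show "A i = B i"
        by (metis bit_not_one_iff)
    qed
    from eq have "{A. \<Phi> A = 1} = {A. \<Psi> A = 1}"
      by (simp only: inj_image_eq_iff[OF inj])
    then have "\<Phi> A = 1 \<longleftrightarrow> \<Psi> A = 1"
      by blast
    then show "\<Phi> A = \<Psi> A"
      by (metis bit_not_one_iff)
  qed
  then show ?thesis
    by (rule that)
qed

theorem mainTheorem11:
  assumes "\<exists>P :: nat set set set.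
             P \<approx> (UNIV :: real set) \<and>
             (\<forall>p\<in>P. selective_ultrafilter p) \<and>
             (\<forall>p\<in>P. \<forall>q\<in>P. p \<noteq> q \<longrightarrow> \<not> rk_le p q \<and> \<not> rk_le q p)"
  shows "\<exists>(G :: (real set set) monoid) T.
           topological_group G T \<and> Hausdorff_space T \<and>
           (\<forall>n::nat. n \<ge> 1 \<longrightarrow> countably_pracompact (product_topology (\<lambda>_. T) {..<n})) \<and>
           \<not> countably_pracompact (product_topology (\<lambda>_. T) (UNIV :: nat set))"
proof -
  from assms obtain P :: "nat set set set" where P: "P \<approx> (UNIV :: real set)" "\<forall>p\<in>P. selective_ultrafilter p"
    "\<forall>p\<in>P. \<forall>q\<in>P. p \<noteq> q \<longrightarrow> \<not> rk_le p q \<and> \<not> rk_le q p"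
    by (elim exE conjE)
  have "(UNIV :: nat set set) \<approx> P"
    by (rule eqpoll_trans[OF nat_sets_eqpoll_reals eqpoll_sym[OF P(1)]])
  then obtain p :: "nat set \<Rightarrow> nat set set" where p: "bij_betw p UNIV P"
    unfolding eqpoll_def by blast
  obtain enc :: "nat \<times> (nat \<Rightarrow> nat \<Rightarrow> bit poly) \<Rightarrow> nat set" where enc: "inj enc"
    by (rule inj_encode_arrays)
  obtain code :: "((nat \<Rightarrow> bit) \<Rightarrow> bit) \<Rightarrow> real set set" where code: "inj code"
    by (rule inj_encode_functionals)
  define dec where "dec = inv_into UNIV enc"
  have dec: "dec (enc x) = x" for x
    by (simp add: dec_def enc)
  \<comment> \<open>An index that does not code an escaping array gets zero rows; the empty array is
    escaping vacuously.\<close>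
  define m where "m s = (if escaping (fst (dec s)) (snd (dec s)) then fst (dec s) else 0)" for s
  define g where "g s = snd (dec s)" for s
  interpret selective_limits p m g code
  proof
    show "selective_ultrafilter (p s)" for s
      using P(2) p by (auto simp: bij_betw_def)
    show "\<not> rk_le (p s) (p t)" if "s \<noteq> t" for s t
      using P(3) p that by (metis bij_betw_def inj_eq rangeI)
    show "escaping (m s) (g s)" for s
      by (auto simp: m_def g_def) (simp add: escaping_def)
    show "\<exists>s. m s = n \<and> (\<forall>j<n. \<forall>l. g s j l = f j l)" if "escaping n f" for n f
      using that by (intro exI[of _ "enc (n, f)"]) (simp add: m_def g_def dec)
    show "inj code"
      by (rule code)
  qed
  show ?thesis
    using topological_group_limit_group Hausdorff_space_limit_topology
      countably_pracompact_finite_power not_countably_pracompact_omega_power by blast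
qed

end
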